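(* (i) For every signature $\tau$ with $\{+,\cdot,0,1\}\subseteq\tau\subseteq\{+,\cdot,\uparrow,\copyright,!,\exp_2,0,1\}$, the algebra $\mathbf{B}_\tau$ lies in the variety generated by $\langle\mathbb{N}_0,\tau\rangle$, and the equational theory of $\mathbf{B}_\tau$ has no finite axiomatisation (no finite set of equations true in $\mathbf{B}_\tau$ entails all equations true in $\mathbf{B}_\tau$). (ii) For every signature $\tau$ with $\{+,\cdot,1\}\subseteq\tau\subseteq\{+,\cdot,\uparrow,\copyright,!,\exp_2,1\}$, the algebra $\mathbf{B}^-_\tau$ lies in the variety generated by $\langle\mathbb{N},\tau\rangle$, and the equational theory of $\mathbf{B}^-_\tau$ has no finite axiomatisation.
   Context: $\mathbb{N}=\{1,2,\dots\}$ and $\mathbb{N}_0=\{0\}\cup\mathbb{N}$. On these, $+,\cdot$ are the usual operations, $x\uparrow y:=x^y$ (with $0^0:=1$), $x\mathbin{\copyright}y:=\binom{x+y}{y}$, $!$ is the unary factorial operation, $\exp_2(x):=2^x$, and $0,1$ are nullary operations (constants). $\langle\mathbb{N}_0,\tau\rangle$ and $\langle\mathbb{N},\tau\rangle$ denote the algebras with the operations in $\tau$. The variety generated by an algebra is the class of all algebras of the same signature satisfying every equation true in it. The algebra $\mathbf{B}$ has universe $\{0,1,2,a,\infty\}$, constants $0$ and $1$, and operations given as follows (the row is the left argument, the column the right argument): $$\begin{array}{c|ccccc} + & 0 & 1 & 2 & a & \infty \\ \hline 0 & 0 & 1 & 2 & a & \infty \\ 1 & 1 & 2 & 2 & \infty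 & \infty \\ 2 & 2 & 2 & 2 & \infty & \infty \\ a & a & \infty & \infty & a & \infty \\ \infty & \infty & \infty & \infty & \infty & \infty \end{array}\qquad\begin{array}{c|ccccc} \cdot & 0 & 1 & 2 & a & \infty \\ \hline 0 & 0 & 0 & 0 & 0 & 0 \\ 1 & 0 & 1 & 2 & a & \infty \\ 2 & 0 & 2 & 2 & a & \infty \\ a & 0 & a & a & \infty & \infty \\ \infty & 0 & \infty & \infty & \infty & \infty \end{array}$$ $$\begin{array}{c|ccccc} \uparrow & 0 & 1 & 2 & a & \infty \\ \hline 0 & 1 & 0 & 0 & 0 & 0 \\ 1 & 1 & 1 & 1 & 1 & 1 \\ 2 & 1 & 2 & 2 & \infty & \infty \\ a & 1 & a & \infty & \infty & \infty \\ \infty & 1 & \infty & \infty & \infty & \infty \end{array}\qquad\begin{array}{c|ccccc} \copyright & 0 & 1 & 2 & a & \infty \\ \hline 0 & 1 & 1 & 1 & 1 & 1 \\ 1 & 1 & 2 & 2 & \infty & \infty \\ 2 & 1 & 2 & 2 & \infty & \infty \\ a & 1 & \infty & \infty & \infty & \infty \\ \infty & 1 & \infty & \infty & \infty & \infty \end{array}$$ $0!=1,\ 1!=1,\ 2!=2,\ a!=\infty,\ \infty!=\infty$; and $\exp_2(0)=1,\ \exp_2(1)=2,\ \exp_2(2)=2,\ \exp_2(a)=\infty,\ \exp_2(\infty)=\infty$. $\mathbf{B}_\tau$ is the reduct of $\mathbf{B}$ to the operations in $\tau$. $\mathbf{B}^-$ is the subalgebra on $\{1,2,a,\infty\}$ (with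 the constant $0$ dropped from the signature), and $\mathbf{B}^-_\tau$ is its reduct to $\tau$. *)

theory Defs
  imports Complex_Main "HOL-Library.Countable_Set"
begin

section \<open>Signatures, terms, algebras\<close>

datatype nullary_op = Zero | One
datatype unary_op = Fact | Exp2
datatype binary_op = Add | Mul | Exp | Binom  \<comment> \<open>\<open>Binom\<close> is the copyright-sign operation\<close>

datatype opsym = Nullary nullary_op | Unary unary_op | Binary binary_op

datatype trm =
    Var nat
  | App0 nullary_op
  | App1 unary_op trm
  | App2 binary_op trm trm

instance nullary_op :: countable by countable_datatype
instance unary_op :: countable by countable_datatype
instance binary_op :: countable by countable_datatype
instance trm :: countable by countable_datatype

type_synonym equation = "trm \<times> trm"

primrec opsyms :: "trm \<Rightarrow> opsym set" where
  "opsyms (Var n) = {}"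
| "opsyms (App0 f) = {Nullary f}"
| "opsyms (App1 f s) = insert (Unary f) (opsyms s)"
| "opsyms (App2 f s t) = insert (Binary f) (opsyms s \<union> opsyms t)"

definition terms :: "opsym set \<Rightarrow> trm set" where
  "terms \<tau> = {t. opsyms t \<subseteq> \<tau>}"

definition equations :: "opsym set \<Rightarrow> equation set" where
  "equations \<tau> = terms \<tau> \<times> terms \<tau>"

text \<open>
  The signature is kept separate from the record: everything below refers to an algebra
  together with a signature \<open>\<tau>\<close>, and the interpretations of symbols outside \<open>\<tau>\<close> are never
  consulted.  Hence the reduct of \<open>A\<close> to \<open>\<tau>\<close> is given by the same record \<open>A\<close>, used with \<open>\<tau>\<close>.
\<close>

record 'a algebra =
  carrier :: "'a set"
  op0 :: "nullary_op \<Rightarrow> 'a"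
  op1 :: "unary_op \<Rightarrow> 'a \<Rightarrow> 'a"
  op2 :: "binary_op \<Rightarrow> 'a \<Rightarrow> 'a \<Rightarrow> 'a"

definition is_algebra :: "opsym set \<Rightarrow> 'a algebra \<Rightarrow> bool" where
  "is_algebra \<tau> A \<longleftrightarrow>
     carrier A \<noteq> {} \<and>
     (\<forall>f. Nullary f \<in> \<tau> \<longrightarrow> op0 A f \<in> carrier A) \<and>
     (\<forall>f. Unary f \<in> \<tau> \<longrightarrow> (\<forall>x\<in>carrier A. op1 A f x \<in> carrier A)) \<and>
     (\<forall>f. Binary f \<in> \<tau> \<longrightarrow> (\<forall>x\<in>carrier A. \<forall>y\<in>carrier A. op2 A f x y \<in> carrier A))"

primrec eval :: "'a algebra \<Rightarrow> (nat \<Rightarrow> 'a) \<Rightarrow> trm \<Rightarrow> 'a" where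
  "eval A v (Var n) = v n"
| "eval A v (App0 f) = op0 A f"
| "eval A v (App1 f s) = op1 A f (eval A v s)"
| "eval A v (App2 f s t) = op2 A f (eval A v s) (eval A v t)"

definition satisfies :: "'a algebra \<Rightarrow> equation \<Rightarrow> bool" where
  "satisfies A e \<longleftrightarrow>
     (\<forall>v. range v \<subseteq> carrier A \<longrightarrow> eval A v (fst e) = eval A v (snd e))"

definition eq_theory :: "opsym set \<Rightarrow> 'a algebra \<Rightarrow> equation set" where
  "eq_theory \<tau> A = {e \<in> equations \<tau>. satisfies A e}"

definition in_variety_generated_by :: "opsym set \<Rightarrow> 'a algebra \<Rightarrow> 'b algebra \<Rightarrow> bool" where
  "in_variety_generated_by \<tau> A G \<longleftrightarrow>
     is_algebra \<tau> A \<and> (\<forall>e \<in> eq_theory \<tau> G. satisfies A e)"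


section \<open>Entailment and finite axiomatisability\<close>

text \<open>
  \<open>entails \<tau> E e\<close>: every algebra of signature \<open>\<tau>\<close> satisfying \<open>E\<close> satisfies \<open>e\<close>.
  A definition in HOL cannot quantify over all carrier types, so it quantifies over algebras
  whose carrier is a set of natural numbers; the lemma \<open>entails_any_type\<close> below shows that
  for equations of signature \<open>\<tau>\<close> this already gives the property for algebras over every type
  (an algebra refuting \<open>e\<close> has a countable subalgebra refuting \<open>e\<close>).
\<close>

definition entails :: "opsym set \<Rightarrow> equation set \<Rightarrow> equation \<Rightarrow> bool" where
  "entails \<tau> E e \<longleftrightarrow>
     (\<forall>A :: nat algebra. is_algebra \<tau> A \<and> (\<forall>d\<in>E. satisfies A d) \<longrightarrow> satisfies A e)"

definition finitely_axiomatisable :: "opsym set \<Rightarrow> 'a algebra \<Rightarrow> bool" where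
  "finitely_axiomatisable \<tau> A \<longleftrightarrow>
     (\<exists>E. finite E \<and> E \<subseteq> eq_theory \<tau> A \<and> (\<forall>e \<in> eq_theory \<tau> A. entails \<tau> E e))"

lemma eval_in_carrier:
  assumes "is_algebra \<tau> A" "t \<in> terms \<tau>" "range v \<subseteq> carrier A"
  shows "eval A v t \<in> carrier A"
  using assms(2)
proof (induction t)
  case (Var n)
  then show ?case using assms(3) by auto
qed (use assms(1) in \<open>auto simp: terms_def is_algebra_def\<close>)

lemma entails_any_type:
  fixes A :: "'a algebra"
  assumes E: "E \<subseteq> equations \<tau>" and e: "e \<in> equations \<tau>"
    and ent: "entails \<tau> E e"
    and A: "is_algebra \<tau> A" and sat: "\<forall>d\<in>E. satisfies A d"
  shows "satisfies A e"
  unfolding satisfies_def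
proof (intro allI impI)
  fix v :: "nat \<Rightarrow> 'a"
  assume v: "range v \<subseteq> carrier A"
  define S where "S = eval A v ` terms \<tau>"
  define f where "f = to_nat_on S"
  define g where "g = inv_into S f"
  have "countable S" by (simp add: S_def)
  then have inj: "inj_on f S" by (simp add: f_def inj_on_to_nat_on)
  then have gf: "g (f x) = x" if "x \<in> S" for x using that by (simp add: g_def)
  have S0: "S \<subseteq> carrier A"
    using eval_in_carrier[OF A _ v] by (auto simp: S_def)
  have vS: "v n \<in> S" for n
    unfolding S_def by (rule image_eqI[of _ _ "Var n"]) (auto simp: terms_def)
  have c0: "op0 A h \<in> S" if "Nullary h \<in> \<tau>" for h
    unfolding S_def by (rule image_eqI[of _ _ "App0 h"]) (use that in \<open>auto simp: terms_def\<close>)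
  have c1: "op1 A h x \<in> S" if h1: "Unary h \<in> \<tau>" "x \<in> S" for h x
  proof -
    from h1 obtain t where "t \<in> terms \<tau>" "x = eval A v t"
      unfolding S_def by auto
    then show ?thesis
      unfolding S_def by (intro image_eqI[of _ _ "App1 h t"]) (use h1 in \<open>auto simp: terms_def\<close>)
  qed
  have c2: "op2 A h x y \<in> S" if h2: "Binary h \<in> \<tau>" "x \<in> S" "y \<in> S" for h x y
  proof -
    obtain t u where "t \<in> terms \<tau>" "x = eval A v t" "u \<in> terms \<tau>" "y = eval A v u"
      using h2 unfolding S_def by auto
    then show ?thesis
      unfolding S_def by (intro image_eqI[of _ _ "App2 h t u"]) (use h2 in \<open>auto simp: terms_def\<close>)
  qed
  define N :: "nat algebra" where
    "N = \<lparr>carrier = f ` S, op0 = \<lambda>h. f (op0 A h), op1 = \<lambda>h x. f (op1 A h (g x)),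
          op2 = \<lambda>h x y. f (op2 A h (g x) (g y))\<rparr>"
  have N: "is_algebra \<tau> N"
    using vS by (auto simp: is_algebra_def N_def gf c0 c1 c2)
  have ev: "eval A w t \<in> S \<and> eval N (\<lambda>n. f (w n)) t = f (eval A w t)"
    if "t \<in> terms \<tau>" "range w \<subseteq> S" for t w
    using that by (induction t) (auto simp: terms_def N_def gf c0 c1 c2)
  have "satisfies N d" if d: "d \<in> E" for d
    unfolding satisfies_def
  proof (intro allI impI)
    fix u :: "nat \<Rightarrow> nat"
    assume u: "range u \<subseteq> carrier N"
    define w where "w = (\<lambda>n. g (u n))"
    have "u n \<in> f ` S" for n using u by (auto simp: N_def)
    then have "w n \<in> S \<and> f (w n) = u n" for n
      by (metis (no_types, lifting) gf imageE w_def)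
    then have w: "range w \<subseteq> S" and fw: "(\<lambda>n. f (w n)) = u" by auto
    have "fst d \<in> terms \<tau>" "snd d \<in> terms \<tau>" using E d by (auto simp: equations_def)
    moreover have "eval A w (fst d) = eval A w (snd d)"
      using sat d w S0 unfolding satisfies_def by blast
    ultimately show "eval N u (fst d) = eval N u (snd d)" using ev w fw by metis
  qed
  then have "satisfies N e" using ent N by (simp add: entails_def)
  moreover have "range (\<lambda>n. f (v n)) \<subseteq> carrier N" using vS by (auto simp: N_def)
  ultimately have "eval N (\<lambda>n. f (v n)) (fst e) = eval N (\<lambda>n. f (v n)) (snd e)"
    unfolding satisfies_def by blast
  moreover have "fst e \<in> terms \<tau>" "snd e \<in> terms \<tau>" using e by (auto simp: equations_def)
  moreover have "range v \<subseteq> S" using vS by auto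
  ultimately have "f (eval A v (fst e)) = f (eval A v (snd e))"
    and "eval A v (fst e) \<in> S" "eval A v (snd e) \<in> S"
    using ev by metis+
  then show "eval A v (fst e) = eval A v (snd e)"
    using inj by (meson inj_onD)
qed


section \<open>The natural numbers and the algebra \<open>B\<close>\<close>

primrec nat_op0 :: "nullary_op \<Rightarrow> nat" where
  "nat_op0 Zero = 0"
| "nat_op0 One = 1"

primrec nat_op1 :: "unary_op \<Rightarrow> nat \<Rightarrow> nat" where
  "nat_op1 Fact = (\<lambda>x. fact x)"
| "nat_op1 Exp2 = (\<lambda>x. 2 ^ x)"

primrec nat_op2 :: "binary_op \<Rightarrow> nat \<Rightarrow> nat \<Rightarrow> nat" where
  "nat_op2 Add = (\<lambda>x y. x + y)"
| "nat_op2 Mul = (\<lambda>x y. x * y)"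
| "nat_op2 Exp = (\<lambda>x y. x ^ y)"
| "nat_op2 Binom = (\<lambda>x y. (x + y) choose y)"

definition alg_N0 :: "nat algebra" where
  "alg_N0 = \<lparr>carrier = UNIV, op0 = nat_op0, op1 = nat_op1, op2 = nat_op2\<rparr>"

text \<open>Used only with signatures that do not contain the constant \<open>Zero\<close>.\<close>

definition alg_N :: "nat algebra" where
  "alg_N = alg_N0\<lparr>carrier := {1..}\<rparr>"

datatype b_elem = B0 | B1 | B2 | Ba | Binf

text \<open>A row lists the values at \<open>B0\<close>, \<open>B1\<close>, \<open>B2\<close>, \<open>Ba\<close>, \<open>Binf\<close>, in this order.\<close>

abbreviation row :: "'c \<Rightarrow> 'c \<Rightarrow> 'c \<Rightarrow> 'c \<Rightarrow> 'c \<Rightarrow> b_elem \<Rightarrow> 'c" where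
  "row \<equiv> case_b_elem"

primrec b_op0 :: "nullary_op \<Rightarrow> b_elem" where
  "b_op0 Zero = B0"
| "b_op0 One = B1"

primrec b_op1 :: "unary_op \<Rightarrow> b_elem \<Rightarrow> b_elem" where
  "b_op1 Fact = row B1 B1 B2 Binf Binf"
| "b_op1 Exp2 = row B1 B2 B2 Binf Binf"

primrec b_op2 :: "binary_op \<Rightarrow> b_elem \<Rightarrow> b_elem \<Rightarrow> b_elem" where
  "b_op2 Add = row
     (row B0   B1   B2   Ba   Binf)
     (row B1   B2   B2   Binf Binf)
     (row B2   B2   B2   Binf Binf)
     (row Ba   Binf Binf Ba   Binf)
     (row Binf Binf Binf Binf Binf)"
| "b_op2 Mul = row
     (row B0   B0   B0   B0   B0)
     (row B0   B1   B2   Ba   Binf)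
     (row B0   B2   B2   Ba   Binf)
     (row B0   Ba   Ba   Binf Binf)
     (row B0   Binf Binf Binf Binf)"
| "b_op2 Exp = row
     (row B1   B0   B0   B0   B0)
     (row B1   B1   B1   B1   B1)
     (row B1   B2   B2   Binf Binf)
     (row B1   Ba   Binf Binf Binf)
     (row B1   Binf Binf Binf Binf)"
| "b_op2 Binom = row
     (row B1   B1   B1   B1   B1)
     (row B1   B2   B2   Binf Binf)
     (row B1   B2   B2   Binf Binf)
     (row B1   Binf Binf Binf Binf)
     (row B1   Binf Binf Binf Binf)"

definition alg_B :: "b_elem algebra" where
  "alg_B = \<lparr>carrier = UNIV, op0 = b_op0, op1 = b_op1, op2 = b_op2\<rparr>"

text \<open>As for \<open>alg_N\<close>, used only with signatures that do not contain \<open>Zero\<close>.\<close>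

definition alg_B_minus :: "b_elem algebra" where
  "alg_B_minus = alg_B\<lparr>carrier := {B1, B2, Ba, Binf}\<rparr>"

end

theory Submission
  imports Defs
begin

text \<open>
  Membership in the variety. Read an element of \<open>B\<close> as a growth class of functions on the natural
  numbers: \<open>B0\<close>, \<open>B1\<close> and \<open>B2\<close> are the constants \<open>0\<close>, \<open>1\<close> and at least \<open>2\<close>; \<open>Ba\<close> consists of the
  multiples \<open>k * x\<close> with \<open>k > 0\<close>; and \<open>Binf\<close> consists of \<open>k * x + c\<close> with \<open>k, c > 0\<close> together with
  everything superlinear. The tables of \<open>B\<close> record how these classes are combined by the operations,
  applied pointwise (\<open>germ_eval\<close>), and a function belongs eventually to at most one class
  (\<open>germ_unique\<close>). So an equation of the natural numbers, evaluated at representatives of the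
  classes, gives the same equation in \<open>B\<close>.
  
  No finite basis. On arguments other than \<open>B0\<close>, a sum of square-free monomials takes the value
  \<open>Ba\<close> exactly if no variable is \<open>Binf\<close> and every monomial contains exactly one variable with value
  \<open>Ba\<close>. Take a 3-uniform hypergraph \<open>E\<close> on variables, and the sum \<open>t\<close> of the monomials \<open>x * y * z\<close>
  over its edges. If no set of vertices meets every edge in exactly one point, then \<open>t\<close> never takes
  the value \<open>Ba\<close> while all variables are nonzero, and so \<open>B\<close> satisfies \<open>t = t + w * w\<close>, where \<open>w\<close> is
  the product of all variables; a zero among the variables makes the new summand vanish
  (\<open>hitting_equation_holds\<close>). Such a set cannot exist when every vertex has degree 3 and the number of
  edges is not divisible by 3, by double counting (\<open>cubic_no_exact_hitting\<close>).
  
  This inconsistency is invisible locally if \<open>E\<close> has no short cycles. In a forest of triples, the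
  membership of any two vertices in an exact hitting set may be prescribed at will, except that two
  vertices of one edge cannot both be chosen (\<open>hyperforest_two_point_extension\<close>). From \<open>E\<close> one builds
  an algebra \<open>hyp_alg E\<close> whose elements are the numerals, the vertices, products of two vertices
  of an edge, the common value of all edges, and an absorbing element. An evaluation of finitely
  many variables in \<open>hyp_alg E\<close> involves only few edges, which form a forest; every exact hitting set
  of that forest turns it into an evaluation in \<open>B\<close>, and together these evaluations determine the
  value in \<open>hyp_alg E\<close> (\<open>eval_eq_transfer\<close>). Hence \<open>hyp_alg E\<close> satisfies every equation of \<open>B\<close> in few
  variables. It violates \<open>t = t + w * w\<close> (\<open>hitting_equation_fails\<close>). As a finite set of equations has
  a bounded number of variables, no such set axiomatises \<open>B\<close>. The operations other than addition and
  multiplication treat all non-numeric elements alike, except that \<open>x\<close> to the power \<open>1\<close> is \<open>x\<close>, so the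
  argument is uniform in the signature, and removing zero from the carriers on both sides covers the second half.
  
  Suitable hypergraphs come from the complete 3-uniform hypergraph on four points by repeatedly
  passing to a covering whose sheets are indexed by sets of incidences. The number of edges is
  multiplied by a power of 2, so it stays prime to 3; degrees are preserved; and cycles get longer,
  because a closed walk upstairs has to use each incidence downstairs an even number of times
  (\<open>cycle_free_lift\<close>).
\<close>

section \<open>Sets meeting every edge of a hyperforest exactly once\<close>

text \<open>
  Forests are built by attaching one triple at a time along at most one old vertex \<open>s\<close>; the vertex
  \<open>s\<close> may also be new. This form provides the induction in the next lemma.
\<close>
inductive hyperforest :: "'v set set \<Rightarrow> bool" where
  empty: "hyperforest {}"
| insert: "hyperforest F \<Longrightarrow> e \<notin> F \<Longrightarrow> e = {s, p, q} \<Longrightarrow> s \<noteq> p \<Longrightarrow> s \<noteq> q \<Longrightarrow> p \<noteq> q \<Longrightarrow>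
    p \<notin> \<Union>F \<Longrightarrow> q \<notin> \<Union>F \<Longrightarrow> hyperforest (insert e F)"

definition exact_hitting :: "'v set set \<Rightarrow> 'v set \<Rightarrow> bool" where
  "exact_hitting F A \<longleftrightarrow> (\<forall>e\<in>F. \<exists>x. e \<inter> A = {x})"

text \<open>
  Attaching a leaf edge \<open>{s, p, q}\<close> leaves the private vertices \<open>p\<close> and \<open>q\<close> free, and whatever the
  status of \<open>s\<close>, they can be chosen to make the edge exact. If one of them is prescribed, that
  prescription amounts to at most one prescription at \<open>s\<close>, so that the smaller forest again has to
  meet only two. Three prescriptions would be too many: three chosen vertices can exclude all
  vertices of an edge.
\<close>
lemma hyperforest_two_point_extension:
  assumes "hyperforest F"
    and "u = w \<Longrightarrow> c = d"
    and "c \<Longrightarrow> d \<Longrightarrow> u \<noteq> w \<Longrightarrow> \<not> (\<exists>e\<in>F. u \<in> e \<and> w \<in> e)"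
  shows "\<exists>A. exact_hitting F A \<and> (u \<in> A \<longleftrightarrow> c) \<and> (w \<in> A \<longleftrightarrow> d)"
  using assms
proof (induction arbitrary: u w c d)
  case empty
  show ?case
    by (rule exI[of _ "{x. (x = u \<and> c) \<or> (x = w \<and> d)}"]) (use empty in \<open>auto simp: exact_hitting_def\<close>)
next
  case (insert F e s p q)
  define keep where "keep A X = (A - {p, q}) \<union> X" for A X :: "'a set"
  have keep_F: "exact_hitting F (keep A X)" if "exact_hitting F A" "X \<subseteq> {p, q}" for A X
  proof -
    have "f \<inter> keep A X = f \<inter> A" if "f \<in> F" for f
      using that \<open>X \<subseteq> {p, q}\<close> insert.hyps(7,8) by (auto simp: keep_def)
    then show ?thesis using that(1) by (simp add: exact_hitting_def)
  qed
  have keep: "exact_hitting (insert e F) (keep A X)"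
    if "exact_hitting F A" "X = {} \<and> s \<in> A \<or> X = {p} \<and> s \<notin> A \<or> X = {q} \<and> s \<notin> A" for A X
  proof -
    have "e \<inter> keep A X = {s} \<or> e \<inter> keep A X = {p} \<or> e \<inter> keep A X = {q}"
      using that(2) insert.hyps(3-6) by (auto simp: keep_def)
    moreover have "exact_hitting F (keep A X)" using keep_F that by blast
    ultimately show ?thesis by (auto simp: exact_hitting_def)
  qed
  have one: "\<exists>A. exact_hitting F A \<and> (x \<in> A \<longleftrightarrow> b)" for x b
    using insert.IH[of x x b b] by blast
  \<comment> \<open>A prescription at a private vertex \<open>x\<close> of the new edge; \<open>r\<close> is the other private vertex.\<close>
  have leaf: "\<exists>A. exact_hitting (insert e F) A \<and> (x \<in> A \<longleftrightarrow> b) \<and> (y \<in> A \<longleftrightarrow> b')"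
    if pq: "x = p \<and> r = q \<or> x = q \<and> r = p" and eq: "x = y \<Longrightarrow> b = b'"
      and nb: "b \<Longrightarrow> b' \<Longrightarrow> x \<noteq> y \<Longrightarrow> \<not> (\<exists>f\<in>insert e F. x \<in> f \<and> y \<in> f)" for x r y b b'
  proof -
    have xr: "x \<noteq> r" using pq insert.hyps(6) by blast
    have re: "x \<in> e" "r \<in> e" "s \<in> e"
      using pq insert.hyps by auto
    have keep': "exact_hitting (insert e F) (keep A X)"
      if "exact_hitting F A" "X = {} \<and> s \<in> A \<or> X = {x} \<and> s \<notin> A \<or> X = {r} \<and> s \<notin> A" for A X
      using keep[OF that(1), of X] that(2) pq by blast
    have mem: "x \<in> keep A X \<longleftrightarrow> x \<in> X" "r \<in> keep A X \<longleftrightarrow> r \<in> X"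
      "z \<noteq> x \<Longrightarrow> z \<noteq> r \<Longrightarrow> z \<in> keep A X \<longleftrightarrow> z \<in> A \<or> z \<in> X" for z A X
      using pq by (auto simp: keep_def)
    consider "y = x" | "y = r" | "y \<noteq> x" "y \<noteq> r" by blast
    then show ?thesis
    proof cases
      case 1
      obtain A where A: "exact_hitting F A" "s \<notin> A" using one[of s False] by auto
      have "exact_hitting (insert e F) (keep A (if b then {x} else {r}))"
        by (rule keep'[OF A(1)]) (simp add: A(2))
      then show ?thesis using 1 eq xr mem(1)[of A "if b then {x} else {r}"] by (auto split: if_splits)
    next
      case 2
      then have nn: "\<not> (b \<and> b')" using nb re xr by blast
      obtain A where A: "exact_hitting F A" "s \<in> A \<longleftrightarrow> \<not> b \<and> \<not> b'"
        using one[of s "\<not> b \<and> \<not> b'"] by auto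
      define X where "X = (if b then {x} else if b' then {r} else {})"
      have "exact_hitting (insert e F) (keep A X)"
        by (rule keep'[OF A(1)]) (simp add: A(2) X_def)
      moreover have "x \<in> X \<longleftrightarrow> b" "r \<in> X \<longleftrightarrow> b'"
        using nn xr by (simp_all add: X_def)
      ultimately show ?thesis using 2 mem(1,2) by blast
    next
      case 3
      show ?thesis
      proof (cases b)
        case True
        have sy: "s = y \<Longrightarrow> \<not> b'" using nb True 3 re by blast
        obtain A where A: "exact_hitting F A" "s \<notin> A" "y \<in> A \<longleftrightarrow> b'"
          using insert.IH[of s y False b'] sy by auto
        have "exact_hitting (insert e F) (keep A {x})"
          by (rule keep'[OF A(1)]) (simp add: A(2))
        then show ?thesis using A(3) 3 True mem(1)[of A "{x}"] mem(3)[of y A "{x}"] by blast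
      next
        case False
        obtain A where A: "exact_hitting F A" "y \<in> A \<longleftrightarrow> b'" using one[of y b'] by auto
        define X where "X = (if s \<in> A then {} else {r})"
        have "exact_hitting (insert e F) (keep A X)"
          by (rule keep'[OF A(1)]) (simp add: X_def)
        moreover have "x \<notin> X" "y \<notin> X" using xr 3 by (auto simp: X_def)
        ultimately show ?thesis using A(2) 3 False mem(1)[of A X] mem(3)[of y A X] by blast
      qed
    qed
  qed
  consider r where "u = p \<and> r = q \<or> u = q \<and> r = p" | r where "w = p \<and> r = q \<or> w = q \<and> r = p"
    | "u \<notin> {p, q}" "w \<notin> {p, q}" by blast
  then show ?case
  proof cases
    case 1
    then show ?thesis using insert.prems by (rule leaf)
  next
    case 2
    have "\<exists>A. exact_hitting (insert e F) A \<and> (w \<in> A \<longleftrightarrow> d) \<and> (u \<in> A \<longleftrightarrow> c)"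
      using 2 by (rule leaf) (use insert.prems in blast)+
    then show ?thesis by blast
  next
    case 3
    obtain A where A: "exact_hitting F A" "u \<in> A \<longleftrightarrow> c" "w \<in> A \<longleftrightarrow> d"
      using insert.IH[of u w c d] insert.prems by blast
    define X where "X = (if s \<in> A then {} else {p})"
    have "exact_hitting (insert e F) (keep A X)"
      by (rule keep[OF A(1)]) (simp add: X_def)
    moreover have "u \<in> keep A X \<longleftrightarrow> u \<in> A" "w \<in> keep A X \<longleftrightarrow> w \<in> A"
      using 3 by (auto simp: X_def keep_def)
    ultimately show ?thesis using A(2,3) by blast
  qed
qed

section \<open>Cubic hypergraphs without short cycles\<close>

definition shared :: "'v set set \<Rightarrow> 'v set \<Rightarrow> 'v \<Rightarrow> bool" where
  "shared F e x \<longleftrightarrow> x \<in> e \<and> (\<exists>f\<in>F. f \<noteq> e \<and> x \<in> f)"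

text \<open>
  Every small nonempty set of edges has a leaf. For sets with at most \<open>N\<close> edges this says that
  they contain no cycle, without mentioning walks.
\<close>
definition cycle_free_upto :: "nat \<Rightarrow> 'v set set \<Rightarrow> bool" where
  "cycle_free_upto N E \<longleftrightarrow>
     (\<forall>F\<subseteq>E. F \<noteq> {} \<longrightarrow> card F \<le> N \<longrightarrow> (\<exists>e\<in>F. \<forall>x y. shared F e x \<longrightarrow> shared F e y \<longrightarrow> x = y))"

definition cubic :: "'v set set \<Rightarrow> bool" where
  "cubic E \<longleftrightarrow> finite E \<and> (\<forall>e\<in>E. card e = 3) \<and> (\<forall>x\<in>\<Union>E. card {e\<in>E. x \<in> e} = 3)"

lemma cubic_finite:
  assumes "cubic E"
  shows "finite E" "e \<in> E \<Longrightarrow> finite e" "finite (\<Union>E)"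
proof -
  show "finite E" using assms by (simp add: cubic_def)
  show fin: "e \<in> E \<Longrightarrow> finite e" for e
    using assms by (intro card_ge_0_finite) (simp add: cubic_def)
  show "finite (\<Union>E)" using \<open>finite E\<close> fin by blast
qed

lemma cycle_free_imp_hyperforest:
  assumes "cycle_free_upto N E" "\<forall>e\<in>E. card e = 3" "F \<subseteq> E" "finite F" "card F \<le> N"
  shows "hyperforest F"
  using assms(4,3,5)
proof (induction F rule: finite_psubset_induct)
  case (psubset F)
  show ?case
  proof (cases "F = {}")
    case False
    then obtain e where e: "e \<in> F" and leaf: "\<And>x y. shared F e x \<Longrightarrow> shared F e y \<Longrightarrow> x = y"
      using assms(1) psubset.prems unfolding cycle_free_upto_def by metis
    have "card e = 3" using assms(2) e psubset.prems by blast
    then obtain a b c where abc: "e = {a, b, c}" "a \<noteq> b" "a \<noteq> c" "b \<noteq> c"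
      by (auto simp: card_3_iff)
    have "shared F e x" if "x \<in> e" "x \<in> \<Union>(F - {e})" for x using that unfolding shared_def by blast
    then have one: "x = y" if "x \<in> e" "y \<in> e" "x \<in> \<Union>(F - {e})" "y \<in> \<Union>(F - {e})" for x y
      using that leaf by blast
    obtain s p q where spq: "e = {s, p, q}" "s \<noteq> p" "s \<noteq> q" "p \<noteq> q" "p \<notin> \<Union>(F - {e})" "q \<notin> \<Union>(F - {e})"
    proof (cases "a \<in> \<Union>(F - {e})")
      case True
      show ?thesis
        by (rule that[of a b c]) (use True abc one[of a b] one[of a c] in blast)+
    next
      case na: False
      show ?thesis
      proof (cases "b \<in> \<Union>(F - {e})")
        case True
        show ?thesis
          by (rule that[of b a c]) (use True abc na one[of b c] in blast)+
      next
        case False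
        show ?thesis
          by (rule that[of c a b]) (use abc na False in blast)+
      qed
    qed
    have "hyperforest (F - {e})"
      using psubset.prems e psubset.hyps by (intro psubset.IH) (auto intro: order.trans[OF card_Diff1_le])
    from hyperforest.insert[OF this _ spq] e show ?thesis by (simp add: insert_absorb)
  qed (simp add: hyperforest.empty)
qed

text \<open>
  Counting incident pairs with the vertex in \<open>A\<close> would give one per edge and three per vertex.
\<close>
lemma cubic_no_exact_hitting:
  assumes "cubic E" "\<not> 3 dvd card E"
  shows "\<not> exact_hitting E A"
proof
  assume A: "exact_hitting E A"
  note fin = cubic_finite[OF assms(1)]
  have "(\<Sum>e\<in>E. card {x\<in>A \<inter> \<Union>E. x \<in> e}) = 3 * card (A \<inter> \<Union>E)"
  proof (rule sum_multicount[OF fin(1)])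
    show "finite (A \<inter> \<Union>E)" using fin(3) by (rule finite_Int[OF disjI2])
    show "\<forall>x\<in>A \<inter> \<Union>E. card {e\<in>E. x \<in> e} = 3" using assms(1) unfolding cubic_def by (metis IntD2)
  qed
  moreover have "card {x\<in>A \<inter> \<Union>E. x \<in> e} = 1" if "e \<in> E" for e
  proof -
    obtain x where "e \<inter> A = {x}" using A \<open>e \<in> E\<close> unfolding exact_hitting_def by blast
    moreover have "{x\<in>A \<inter> \<Union>E. x \<in> e} = e \<inter> A" using that by blast
    ultimately show ?thesis by simp
  qed
  ultimately show False using assms(2) by simp
qed

definition flip :: "'i \<Rightarrow> 'i set \<Rightarrow> 'i set" where
  "flip i S = {j. (j \<in> S) \<noteq> (j = i)}"

lemma flip_flip [simp]: "flip i (flip i S) = S"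
  by (auto simp: flip_def)

lemma flip_inject [simp]: "flip i S = flip i T \<longleftrightarrow> S = T"
  by (metis flip_flip)

lemma flip_Pow: "i \<in> I \<Longrightarrow> S \<in> Pow I \<Longrightarrow> flip i S \<in> Pow I"
  by (auto simp: flip_def)

text \<open>
  The covering of \<open>E\<close> with sheets indexed by sets of incidences: passing from an edge to one of its
  vertices toggles the incidence just used. The sheet thus records the parity of the number of
  times each incidence has been traversed.
\<close>
definition lift_edge :: "'v set \<times> ('v \<times> 'v set) set \<Rightarrow> ('v \<times> ('v \<times> 'v set) set) set" where
  "lift_edge g = (\<lambda>x. (x, flip (x, fst g) (snd g))) ` fst g"

definition incidences :: "'v set set \<Rightarrow> ('v \<times> 'v set) set" where
  "incidences E = {(x, e). e \<in> E \<and> x \<in> e}"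

definition lift :: "'v set set \<Rightarrow> ('v \<times> ('v \<times> 'v set) set) set set" where
  "lift E = lift_edge ` (E \<times> Pow (incidences E))"

lemma mem_lift_edge: "(x, T) \<in> lift_edge (e, S) \<longleftrightarrow> x \<in> e \<and> T = flip (x, e) S"
  by (auto simp: lift_edge_def)

lemma mem_lift_edge': "x \<in> lift_edge g \<longleftrightarrow> fst x \<in> fst g \<and> snd x = flip (fst x, fst g) (snd g)"
  by (cases x; cases g) (simp add: mem_lift_edge)

lemma fst_lift_edge: "fst ` lift_edge g = fst g"
  by (auto simp: lift_edge_def image_iff)

lemma inj_lift_edge: "inj_on lift_edge {g. fst g \<noteq> {}}"
proof (rule inj_onI)
  fix g h :: "'a set \<times> ('a \<times> 'a set) set"
  assume g: "g \<in> {g. fst g \<noteq> {}}" and eq: "lift_edge g = lift_edge h"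
  have f: "fst g = fst h" using eq by (metis fst_lift_edge)
  obtain x where x: "x \<in> fst g" using g by blast
  then have "(x, flip (x, fst g) (snd g)) \<in> lift_edge h" by (simp add: mem_lift_edge' flip: eq)
  then show "g = h" using f by (simp add: mem_lift_edge' prod_eq_iff)
qed

lemma cubic_lift:
  assumes "cubic E"
  shows "cubic (lift E)" and "card (lift E) = card E * 2 ^ card (incidences E)"
proof -
  note fin = cubic_finite[OF assms]
  have "incidences E \<subseteq> \<Union>E \<times> E" by (auto simp: incidences_def)
  then have finI: "finite (incidences E)" using fin(1,3) by (meson finite_SigmaI finite_subset)
  have ne: "E \<times> Pow (incidences E) \<subseteq> {g. fst g \<noteq> {}}"
    using assms by (auto simp: cubic_def)
  note inj = inj_on_subset[OF inj_lift_edge ne]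
  show "card (lift E) = card E * 2 ^ card (incidences E)"
    unfolding lift_def using finI by (simp add: card_image[OF inj] card_cartesian_product card_Pow)
  show "cubic (lift E)"
    unfolding cubic_def
  proof (intro conjI ballI)
    show "finite (lift E)" unfolding lift_def using fin finI by simp
    show "card e' = 3" if "e' \<in> lift E" for e'
    proof -
      obtain e S where e: "e \<in> E" "e' = lift_edge (e, S)" using \<open>e' \<in> lift E\<close> unfolding lift_def by blast
      have "inj_on (\<lambda>x. (x, flip (x, e) S)) e" by (auto intro: inj_onI)
      then show ?thesis using assms e by (simp add: lift_edge_def card_image cubic_def)
    qed
    show "card {e' \<in> lift E. v \<in> e'} = 3" if v: "v \<in> \<Union>(lift E)" for v
    proof -
      obtain x T where xT: "v = (x, T)" by (cases v)
      obtain e0 S0 where e0: "e0 \<in> E" "S0 \<in> Pow (incidences E)" "(x, T) \<in> lift_edge (e0, S0)"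
        using v xT unfolding lift_def by blast
      then have x: "x \<in> e0" and T: "T \<in> Pow (incidences E)"
        using flip_Pow[of "(x, e0)" "incidences E" S0] by (auto simp: mem_lift_edge incidences_def)
      have "{e' \<in> lift E. v \<in> e'} = (\<lambda>e. lift_edge (e, flip (x, e) T)) ` {e\<in>E. x \<in> e}" (is "?L = ?R")
      proof (rule set_eqI, rule iffI)
        fix e' assume "e' \<in> ?L"
        then obtain e S where "e \<in> E" "e' = lift_edge (e, S)" "(x, T) \<in> lift_edge (e, S)"
          unfolding lift_def xT by blast
        then show "e' \<in> ?R" by (intro image_eqI[of _ _ e]) (auto simp: mem_lift_edge)
      next
        fix e' assume "e' \<in> ?R"
        then obtain e where e: "e \<in> E" "x \<in> e" "e' = lift_edge (e, flip (x, e) T)" by blast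
        have "flip (x, e) T \<in> Pow (incidences E)"
          by (rule flip_Pow[OF _ T]) (use e in \<open>auto simp: incidences_def\<close>)
        then show "e' \<in> ?L" using e unfolding lift_def xT by (auto simp: mem_lift_edge)
      qed
      moreover have "inj_on (\<lambda>e. lift_edge (e, flip (x, e) T)) {e\<in>E. x \<in> e}"
        by (rule inj_onI) (metis fst_conv fst_lift_edge)
      ultimately have "card {e' \<in> lift E. v \<in> e'} = card {e\<in>E. x \<in> e}"
        by (simp add: card_image)
      then show ?thesis using assms e0(1) x unfolding cubic_def by auto
    qed
  qed
qed

text \<open>
  A family of lifted edges with pairwise distinct projections contains no cycle, since a cycle
  would use some incidence exactly once. Instead of extracting a cycle, the proof cuts the family:
  if the root \<open>g0\<close> shares the vertex \<open>v\<close> with another edge, then the coordinate of the incidence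
  between \<open>v\<close> and \<open>g0\<close> changes only there, so the edges that differ from \<open>g0\<close> in this coordinate
  are attached to the rest at \<open>v\<close> alone. They form a smaller family of the same kind, in which
  another edge through \<open>v\<close> is the root. The root is allowed a single shared vertex because the
  cut takes one away from it.
\<close>
lemma no_lifted_cycle:
  assumes "finite G" "inj_on fst G" "g0 \<in> G"
    and "\<And>g. g \<in> G \<Longrightarrow> g \<noteq> g0 \<Longrightarrow> \<exists>x y. x \<noteq> y \<and> shared (lift_edge ` G) (lift_edge g) x \<and> shared (lift_edge ` G) (lift_edge g) y"
    and "\<exists>x. shared (lift_edge ` G) (lift_edge g0) x"
  shows False
  using assms
proof (induction G arbitrary: g0 rule: finite_psubset_induct)
  case (psubset G)
  have sh: "shared (lift_edge ` G') (lift_edge g) x \<longleftrightarrow> (\<exists>h\<in>G'. h \<noteq> g \<and> x \<in> lift_edge g \<and> x \<in> lift_edge h)"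
    if "G' \<subseteq> G" "g \<in> G'" for G' g x
  proof -
    have "lift_edge h \<noteq> lift_edge g" if "h \<in> G'" "h \<noteq> g" for h
      using that \<open>G' \<subseteq> G\<close> \<open>g \<in> G'\<close> psubset.prems(1) by (metis fst_lift_edge inj_onD subsetD)
    then show ?thesis using \<open>g \<in> G'\<close> unfolding shared_def by (metis (no_types, lifting) imageE imageI)
  qed
  note shG = sh[OF order.refl]
  obtain v f0 where f0: "f0 \<in> G" "f0 \<noteq> g0" "v \<in> lift_edge g0" "v \<in> lift_edge f0"
    using psubset.prems(4) shG[OF psubset.prems(2)] by blast
  define i where "i = (fst v, fst g0)"
  define G1 where "G1 = {g\<in>G. (i \<in> snd g) \<noteq> (i \<in> snd g0)}"
  have ne: "fst g \<noteq> fst h" if "g \<in> G" "h \<in> G" "g \<noteq> h" for g h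
    using that psubset.prems(1) by (meson inj_onD)
  have coord: "(i \<in> snd g) = (i \<in> snd x)"
    if "x \<in> lift_edge g" "g \<in> G" "i \<noteq> (fst x, fst g)" for x g
    using that by (auto simp: mem_lift_edge' flip_def)
  have root: "x = v" if "g \<in> G1" "x \<in> lift_edge g" "x \<in> lift_edge g0" for g x
  proof (rule ccontr)
    assume "x \<noteq> v"
    then have "fst x \<noteq> fst v" using that(3) f0(3) by (auto simp: mem_lift_edge' prod_eq_iff)
    then have "i \<noteq> (fst x, fst g)" "i \<noteq> (fst x, fst g0)" by (auto simp: i_def)
    moreover have "g \<in> G" using that(1) by (simp add: G1_def)
    ultimately have "(i \<in> snd g) = (i \<in> snd x)" "(i \<in> snd g0) = (i \<in> snd x)"
      using coord that(2,3) psubset.prems(2) by blast+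
    then show False using that(1) by (simp add: G1_def)
  qed
  have f0G1: "f0 \<in> G1"
  proof -
    have "(i \<in> snd f0) = (i \<in> snd v)"
      using coord[OF f0(4,1)] ne[OF f0(1) psubset.prems(2) f0(2)] by (auto simp: i_def)
    moreover have "(i \<in> snd v) \<noteq> (i \<in> snd g0)" using f0(3) by (simp add: mem_lift_edge' flip_def i_def)
    ultimately show ?thesis using f0(1) by (simp add: G1_def)
  qed
  have nb: "h \<in> G1" if "g \<in> G1" "x \<in> lift_edge g" "x \<in> lift_edge h" "h \<in> G" "h \<noteq> g0" for g h x
  proof -
    have "g \<noteq> g0" "g \<in> G" using that(1) by (auto simp: G1_def)
    then have "i \<noteq> (fst x, fst g)" "i \<noteq> (fst x, fst h)"
      using ne that(4,5) psubset.prems(2) by (auto simp: i_def)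
    then show ?thesis using coord[OF that(2) \<open>g \<in> G\<close>] coord[OF that(3,4)] that(1,4) by (simp add: G1_def)
  qed
  have stay: "shared (lift_edge ` G1) (lift_edge g) x"
    if g: "g \<in> G1" "shared (lift_edge ` G) (lift_edge g) x" "g \<noteq> f0 \<or> x \<noteq> v" for g x
  proof -
    have gG: "g \<in> G" using g(1) by (simp add: G1_def)
    obtain h where h: "h \<in> G" "h \<noteq> g" "x \<in> lift_edge g" "x \<in> lift_edge h"
      using g(2) shG[OF gG] by blast
    have "\<exists>h\<in>G1. h \<noteq> g \<and> x \<in> lift_edge g \<and> x \<in> lift_edge h"
    proof (cases "h = g0")
      case True
      then have "x = v" using root[OF g(1) h(3)] h(4) by blast
      moreover have "f0 \<noteq> g" using \<open>x = v\<close> g(3) by blast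
      ultimately show ?thesis using f0G1 f0(4) h(3) by (intro bexI[of _ f0]) auto
    next
      case False
      then show ?thesis using nb[OF g(1) h(3,4,1)] h by blast
    qed
    then show ?thesis using sh[OF _ g(1)] G1_def by blast
  qed
  have "G1 \<subset> G" using psubset.prems(2) by (auto simp: G1_def)
  moreover have "inj_on fst G1" using psubset.prems(1) by (rule inj_on_subset) (auto simp: G1_def)
  moreover note f0G1
  moreover have "\<exists>x y. x \<noteq> y \<and> shared (lift_edge ` G1) (lift_edge g) x \<and> shared (lift_edge ` G1) (lift_edge g) y"
    if "g \<in> G1" "g \<noteq> f0" for g
  proof -
    have "g \<in> G" "g \<noteq> g0" using that(1) by (auto simp: G1_def)
    then show ?thesis using psubset.prems(3)[of g] stay[OF that(1)] that(2) by blast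
  qed
  moreover have "\<exists>x. shared (lift_edge ` G1) (lift_edge f0) x"
    using psubset.prems(3)[OF f0(1,2)] stay[OF f0G1] by metis
  ultimately show False by (rule psubset.IH)
qed

text \<open>
  A leafless set of lifted edges projects to a leafless set, because a covering is injective on the
  edges through a vertex. By assumption the projection has more than \<open>N\<close> edges; with at most
  \<open>Suc N\<close> edges upstairs the projection is therefore injective, which is the situation excluded by
  \<open>no_lifted_cycle\<close>.
\<close>
lemma cycle_free_lift:
  assumes "cubic E" "cycle_free_upto N E"
  shows "cycle_free_upto (Suc N) (lift E)"
  unfolding cycle_free_upto_def
proof (intro allI impI, rule ccontr)
  fix F' assume F': "F' \<subseteq> lift E" "F' \<noteq> {}" "card F' \<le> Suc N"
    and "\<not> (\<exists>e\<in>F'. \<forall>x y. shared F' e x \<longrightarrow> shared F' e y \<longrightarrow> x = y)"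
  then have two: "\<exists>x y. x \<noteq> y \<and> shared F' e x \<and> shared F' e y" if "e \<in> F'" for e
    using that by blast
  have "finite (lift E)" using cubic_lift(1)[OF assms(1)] by (simp add: cubic_def)
  then have fin: "finite F'" using F'(1) finite_subset by blast
  obtain G where G: "G \<subseteq> E \<times> Pow (incidences E)" "F' = lift_edge ` G" "inj_on lift_edge G"
    using F'(1) unfolding lift_def by (meson subset_image_inj)
  have finG: "finite G" using fin G(2,3) by (simp add: finite_image_iff)
  have cardG: "card G = card F'" using G(2,3) by (simp add: card_image)
  define F where "F = fst ` G"
  have F: "F \<subseteq> E" "F \<noteq> {}" using G F'(2) by (auto simp: F_def)
  have "\<exists>x y. x \<noteq> y \<and> shared F e x \<and> shared F e y" if "e \<in> F" for e
  proof -
    obtain g where g: "g \<in> G" "e = fst g" using \<open>e \<in> F\<close> by (auto simp: F_def)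
    have down: "shared F e (fst x)" if x: "shared F' (lift_edge g) x" for x
    proof -
      obtain h where h: "h \<in> G" "lift_edge h \<noteq> lift_edge g" "x \<in> lift_edge g" "x \<in> lift_edge h"
        using x G(2) unfolding shared_def by blast
      have "fst h \<noteq> fst g"
      proof
        assume eq: "fst h = fst g"
        then have "snd h = snd g" using h(3,4) by (simp add: mem_lift_edge')
        then have "h = g" using eq by (simp add: prod_eq_iff)
        then show False using h(2) by simp
      qed
      then show ?thesis using h g unfolding shared_def F_def by (auto simp: mem_lift_edge')
    qed
    obtain x y where xy: "x \<noteq> y" "shared F' (lift_edge g) x" "shared F' (lift_edge g) y"
      using two g(1) G(2) by blast
    then have "x \<in> lift_edge g" "y \<in> lift_edge g" by (auto simp: shared_def)
    then have "fst x \<noteq> fst y" using xy(1) by (auto simp: mem_lift_edge' prod_eq_iff)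
    then show ?thesis using down xy by blast
  qed
  then have "\<not> card F \<le> N" using assms(2) F unfolding cycle_free_upto_def by metis
  moreover have "card F \<le> card G" unfolding F_def using finG by (rule card_image_le)
  ultimately have "card (fst ` G) = card G" using cardG F'(3) by (simp add: F_def)
  then have inj: "inj_on fst G" using finG by (simp add: eq_card_imp_inj_on)
  obtain g0 where g0: "g0 \<in> G" using G(2) F'(2) by blast
  show False
  proof (rule no_lifted_cycle[OF finG inj g0])
    show "\<exists>x. shared (lift_edge ` G) (lift_edge g0) x" using two g0 G(2) by blast
  qed (use two G(2) in blast)
qed

text \<open>
  The lift changes the type of the vertices; renaming them by natural numbers allows it to be
  iterated.
\<close>
lemma inj_image_transfer:
  assumes inj: "inj_on f (\<Union>E)"
  shows "inj_on ((`) f) E" and "cubic E \<Longrightarrow> cubic ((`) f ` E)"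
    and "finite E \<Longrightarrow> cycle_free_upto N E \<Longrightarrow> cycle_free_upto N ((`) f ` E)"
proof -
  show injE: "inj_on ((`) f) E"
    using inj by (meson Union_upper inj_onI inj_on_image_eq_iff)
  have mem: "f x \<in> f ` e \<longleftrightarrow> x \<in> e" if "x \<in> \<Union>E" "e \<in> E" for x e
    using inj_on_image_mem_iff[OF inj that(1)] that(2) by blast
  {
    assume E: "cubic E"
    have "card (f ` e) = 3" if "e \<in> E" for e
    proof -
      have "inj_on f e" using inj that by (meson Union_upper inj_on_subset)
      then show ?thesis using E that by (simp add: card_image cubic_def)
    qed
    moreover have "card {e' \<in> (`) f ` E. y \<in> e'} = 3" if "y \<in> \<Union>((`) f ` E)" for y
    proof -
      obtain x where x: "x \<in> \<Union>E" "y = f x" using \<open>y \<in> _\<close> by blast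
      have "{e' \<in> (`) f ` E. y \<in> e'} = (`) f ` {e\<in>E. x \<in> e}"
        using mem[OF x(1)] x(2) by (auto simp del: UN_iff)
      moreover have "inj_on ((`) f) {e\<in>E. x \<in> e}" using injE by (rule inj_on_subset) blast
      ultimately have "card {e' \<in> (`) f ` E. y \<in> e'} = card {e\<in>E. x \<in> e}"
        by (simp add: card_image)
      then show ?thesis using E x(1) unfolding cubic_def by metis
    qed
    ultimately show "cubic ((`) f ` E)" using E by (simp add: cubic_def)
  }
  assume finE: "finite E" and sp: "cycle_free_upto N E"
  show "cycle_free_upto N ((`) f ` E)"
    unfolding cycle_free_upto_def
  proof (intro allI impI)
    fix F' assume F': "F' \<subseteq> (`) f ` E" "F' \<noteq> {}" "card F' \<le> N"
    obtain F where F: "F \<subseteq> E" "F' = (`) f ` F" "inj_on ((`) f) F"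
      using F'(1) by (meson subset_image_inj)
    then have "card F \<le> N" "F \<noteq> {}" using F' by (auto simp: card_image)
    then obtain e where e: "e \<in> F" and leaf: "\<And>x y. shared F e x \<Longrightarrow> shared F e y \<Longrightarrow> x = y"
      using sp F(1) unfolding cycle_free_upto_def by metis
    have "\<exists>x0. x = f x0 \<and> shared F e x0" if x: "shared F' (f ` e) x" for x
    proof -
      obtain x0 where x0: "x = f x0" "x0 \<in> e" using x unfolding shared_def by blast
      obtain g where g: "g \<in> F" "f ` g \<noteq> f ` e" "x \<in> f ` g"
        using x F(2) unfolding shared_def by blast
      have "x0 \<in> \<Union>E" "g \<in> E" using x0(2) e g(1) F(1) by auto
      then have "x0 \<in> g" using mem[of x0 g] g(3) x0(1) by simp
      moreover have "g \<noteq> e" using g(2) by blast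
      ultimately show ?thesis using x0 g(1) unfolding shared_def by blast
    qed
    then show "\<exists>e\<in>F'. \<forall>x y. shared F' e x \<longrightarrow> shared F' e y \<longrightarrow> x = y"
      using e leaf unfolding F(2) by (metis imageI)
  qed
qed

lemma exists_locally_acyclic_hypergraph:
  "\<exists>E :: nat set set. cubic E \<and> cycle_free_upto N E \<and> \<not> 3 dvd card E"
proof (induction N)
  case 0
  define E :: "nat set set" where "E = (\<lambda>i. {..<4} - {i}) ` {..<4}"
  have inj: "inj_on (\<lambda>i. {..<4} - {i}) {..<4 :: nat}"
  proof (rule inj_onI)
    fix i j :: nat
    assume "i \<in> {..<4}" "j \<in> {..<4}" and eq: "{..<4} - {i} = {..<4} - {j}"
    then have "{i} = {..<4} - ({..<4} - {i})" "{j} = {..<4} - ({..<4} - {j})" by auto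
    then show "i = j" using eq by auto
  qed
  have "card E = 4" unfolding E_def by (subst card_image[OF inj]) simp
  then have "\<not> 3 dvd card E" by simp
  moreover have "cubic E"
    unfolding cubic_def
  proof (intro conjI ballI)
    show "card {e\<in>E. x \<in> e} = 3" if "x \<in> \<Union>E" for x
    proof -
      have x: "x \<in> {..<4}" using that by (auto simp: E_def)
      have "{e\<in>E. x \<in> e} = (\<lambda>i. {..<4} - {i}) ` ({..<4} - {x})"
        using x unfolding E_def by blast
      moreover have "card ({..<4} - {x}) = 3" using x by simp
      moreover have "inj_on (\<lambda>i. {..<4} - {i}) ({..<4} - {x})" using inj by (rule inj_on_subset) blast
      ultimately show ?thesis by (simp add: card_image)
    qed
  qed (auto simp: E_def)
  moreover have "cycle_free_upto 0 E"
    unfolding cycle_free_upto_def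
  proof (intro allI impI)
    fix F assume "F \<subseteq> E" "F \<noteq> {}" "card F \<le> 0"
    moreover have "finite F" using \<open>F \<subseteq> E\<close> by (rule finite_subset) (simp add: E_def)
    ultimately show "\<exists>e\<in>F. \<forall>x y. shared F e x \<longrightarrow> shared F e y \<longrightarrow> x = y" by simp
  qed
  ultimately show ?case by blast
next
  case (Suc N)
  then obtain E :: "nat set set" where E: "cubic E" "cycle_free_upto N E" "\<not> 3 dvd card E" by blast
  have c: "cubic (lift E)" using cubic_lift(1)[OF E(1)] .
  note fin = cubic_finite[OF c]
  obtain f :: "nat \<times> (nat \<times> nat set) set \<Rightarrow> nat" where f: "inj_on f (\<Union>(lift E))"
    using finite_imp_inj_to_nat_seg[OF fin(3)] by blast
  note t = inj_image_transfer[OF f]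
  have "\<not> 3 dvd card E * 2 ^ card (incidences E)"
  proof
    have "coprime (3::nat) (2 ^ card (incidences E))" by simp
    moreover assume "3 dvd card E * 2 ^ card (incidences E)"
    ultimately show False using E(3) coprime_dvd_mult_left_iff by blast
  qed
  then have "\<not> 3 dvd card ((`) f ` lift E)"
    by (simp add: card_image[OF t(1)] cubic_lift(2)[OF E(1)])
  then show ?case using t(2)[OF c] t(3)[OF fin(1) cycle_free_lift[OF E(1,2)]] by blast
qed

section \<open>The algebra of a hypergraph\<close>

lemma eval_carrier_update [simp]: "eval (A\<lparr>carrier := C\<rparr>) v t = eval A v t"
  by (induction t) auto

lemma carrier_alg_B [simp]: "carrier alg_B = UNIV"
  by (simp add: alg_B_def)

text \<open>
  Besides three numerals and the absorbing element \<open>Inf\<close> there are the vertices \<open>Vert v\<close>, the value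
  \<open>Full\<close> of a whole edge, and for every vertex \<open>v\<close> an element \<open>Co v\<close>, the product of the two other
  vertices of an edge through \<open>v\<close>. One element serves for all edges through \<open>v\<close>: in terms of exact
  hitting sets, the product of the other two vertices is hit if and only if \<open>v\<close> is not, whatever the
  edge, so evaluations in \<open>B\<close> could not tell the products apart.
\<close>
datatype melem = N0 | N1 | N2 | Vert nat | Co nat | Full | Inf

definition h_add :: "melem \<Rightarrow> melem \<Rightarrow> melem" where
  "h_add x y = (if x = N0 then y else if y = N0 then x
     else if x \<in> {N1, N2} \<and> y \<in> {N1, N2} then N2 else if x = y then x else Inf)"

text \<open>
  If two vertices lie in a common edge, then \<open>SOME\<close> picks its third vertex; it is unique as soon as
  two edges share at most one vertex.
\<close>
definition h_mul :: "nat set set \<Rightarrow> melem \<Rightarrow> melem \<Rightarrow> melem" where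
  "h_mul E x y = (if x = N0 \<or> y = N0 then N0 else if x = N1 then y else if y = N1 then x
     else if x = N2 then y else if y = N2 then x
     else case (x, y) of
       (Vert v, Vert w) \<Rightarrow> if v \<noteq> w \<and> (\<exists>u. {u, v, w} \<in> E) then Co (SOME u. {u, v, w} \<in> E) else Inf
     | (Vert v, Co u) \<Rightarrow> if u = v then Full else Inf
     | (Co u, Vert v) \<Rightarrow> if u = v then Full else Inf
     | _ \<Rightarrow> Inf)"

definition h_exp :: "melem \<Rightarrow> melem \<Rightarrow> melem" where
  "h_exp x y = (if y = N0 then N1 else if x \<in> {N0, N1} then x else if y = N1 then x
     else if x = N2 \<and> y = N2 then N2 else Inf)"

definition h_binom :: "melem \<Rightarrow> melem \<Rightarrow> melem" where
  "h_binom x y = (if x = N0 \<or> y = N0 then N1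
     else if x \<in> {N1, N2} \<and> y \<in> {N1, N2} then N2 else Inf)"

primrec h_op0 :: "nullary_op \<Rightarrow> melem" where
  "h_op0 Zero = N0"
| "h_op0 One = N1"

primrec h_op1 :: "unary_op \<Rightarrow> melem \<Rightarrow> melem" where
  "h_op1 Fact = (\<lambda>x. if x \<in> {N0, N1} then N1 else if x = N2 then N2 else Inf)"
| "h_op1 Exp2 = (\<lambda>x. if x = N0 then N1 else if x \<in> {N1, N2} then N2 else Inf)"

primrec h_op2 :: "nat set set \<Rightarrow> binary_op \<Rightarrow> melem \<Rightarrow> melem \<Rightarrow> melem" where
  "h_op2 E Add = h_add"
| "h_op2 E Mul = h_mul E"
| "h_op2 E Exp = h_exp"
| "h_op2 E Binom = h_binom"

definition hyp_alg :: "nat set set \<Rightarrow> melem algebra" where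
  "hyp_alg E = \<lparr>carrier = UNIV, op0 = h_op0, op1 = h_op1, op2 = h_op2 E\<rparr>"

text \<open>
  The shadow in \<open>B\<close> of an element, with respect to a set \<open>A\<close> of chosen vertices: \<open>Ba\<close> if a chosen
  vertex occurs in the element, and \<open>B2\<close> otherwise. Here \<open>Co v\<close> is read under the assumption that
  \<open>A\<close> meets the edges through \<open>v\<close> exactly once.
\<close>
primrec hval :: "nat set \<Rightarrow> melem \<Rightarrow> b_elem" where
  "hval A N0 = B0"
| "hval A N1 = B1"
| "hval A N2 = B2"
| "hval A (Vert v) = (if v \<in> A then Ba else B2)"
| "hval A (Co v) = (if v \<in> A then B2 else Ba)"
| "hval A Full = Ba"
| "hval A Inf = Binf"

text \<open>
  How the value \<open>b\<close> of a term in \<open>B\<close> is related to its value \<open>m\<close> in the hypergraph algebra. A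
  product may be \<open>Inf\<close> because its factors belong to no common edge, while a particular \<open>A\<close> chooses
  none or one of them; then \<open>b\<close> can be \<open>B2\<close> or \<open>Ba\<close>. It cannot be \<open>B0\<close> or \<open>B1\<close>, and only this
  matters for the cases in which an operation ignores its other argument.
\<close>
definition tracks :: "nat set \<Rightarrow> melem \<Rightarrow> b_elem \<Rightarrow> bool" where
  "tracks A m b \<longleftrightarrow> (if m = Inf then b \<notin> {B0, B1} else b = hval A m)"

text \<open>
  A family of values in \<open>B\<close>, indexed by the exact hitting sets of \<open>F\<close>, represents \<open>m\<close> if it tracks
  \<open>m\<close> everywhere and, in the case \<open>m = Inf\<close>, shows it by a value \<open>Binf\<close> somewhere. The second clause
  is what makes the family determine \<open>m\<close>.
\<close>
definition represents :: "nat set set \<Rightarrow> melem \<Rightarrow> (nat set \<Rightarrow> b_elem) \<Rightarrow> bool" where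
  "represents F m b \<longleftrightarrow> (\<forall>A. exact_hitting F A \<longrightarrow> tracks A m (b A)) \<and>
     (m = Inf \<longrightarrow> (\<exists>A. exact_hitting F A \<and> b A = Binf))"

abbreviation numeric :: "melem set" where "numeric \<equiv> {N0, N1, N2}"

section \<open>Recovering the hypergraph algebra from its shadows in B\<close>

lemma tracks_add:
  assumes "tracks A x a" "tracks A y b"
  shows "tracks A (h_add x y) (b_op2 Add a b)"
  using assms
  by (cases x; cases y; cases a; cases b) (auto simp: tracks_def h_add_def split: if_splits)

lemma tracks_mul:
  assumes "tracks A x a" "tracks A y b"
    and edge: "\<And>u v w. x = Vert v \<Longrightarrow> y = Vert w \<Longrightarrow> {u, v, w} \<in> E \<Longrightarrow> v \<noteq> w \<Longrightarrow>
      u \<notin> {v, w} \<and> (\<exists>z. {u, v, w} \<inter> A = {z})"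
  shows "tracks A (h_mul E x y) (b_op2 Mul a b)"
proof (cases "\<exists>v w. x = Vert v \<and> y = Vert w")
  case True
  then obtain v w where vw: "x = Vert v" "y = Vert w" by blast
  have ab: "a = hval A x" "b = hval A y" using assms(1,2) vw by (simp_all add: tracks_def)
  show ?thesis
  proof (cases "v \<noteq> w \<and> (\<exists>u. {u, v, w} \<in> E)")
    case True
    define u where "u = (SOME u. {u, v, w} \<in> E)"
    have "{u, v, w} \<in> E" using True unfolding u_def by (metis (mono_tags) someI_ex)
    then have u: "u \<notin> {v, w}" "\<exists>z. {u, v, w} \<inter> A = {z}"
      using edge[OF vw] True by blast+
    have "h_mul E x y = Co u" using True by (simp add: h_mul_def vw u_def)
    moreover obtain z where z: "{u, v, w} \<inter> A = {z}" using u(2) by blast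
    then have "u \<in> A \<longleftrightarrow> z = u" "v \<in> A \<longleftrightarrow> z = v" "w \<in> A \<longleftrightarrow> z = w" "z = u \<or> z = v \<or> z = w"
      by (blast dest: equalityD1 equalityD2)+
    ultimately show ?thesis using u(1) True by (auto simp: tracks_def ab vw)
  next
    case False
    then have "h_mul E x y = Inf" by (simp add: h_mul_def vw)
    then show ?thesis by (simp add: tracks_def ab vw)
  qed
next
  case False
  then show ?thesis using assms(1,2)
    by (cases x; cases y; cases a; cases b) (auto simp: tracks_def h_mul_def split: if_splits)
qed

lemma tracks_exp:
  assumes "tracks A x a" "tracks A y b"
  shows "tracks A (h_exp x y) (b_op2 Exp a b)"
  using assms
  by (cases x; cases y; cases a; cases b) (simp_all add: tracks_def h_exp_def split: if_splits)

lemma tracks_binom: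
  assumes "tracks A x a" "tracks A y b"
  shows "tracks A (h_binom x y) (b_op2 Binom a b)"
  using assms
  by (cases x; cases y; cases a; cases b) (simp_all add: tracks_def h_binom_def split: if_splits)

lemma tracks_op1:
  assumes "tracks A x a"
  shows "tracks A (h_op1 f x) (b_op1 f a)"
  using assms
  by (cases f; cases x; cases a) (simp_all add: tracks_def split: if_splits)

text \<open>
  The part of the hypergraph that an evaluation can see: \<open>U\<close> contains the vertices assigned to the
  variables, and \<open>F\<close> every edge with two vertices in \<open>U\<close>. Products never produce new elements
  of the form \<open>Vert v\<close>, so no other edges enter a computation.
\<close>
locale acyclic_patch =
  fixes E :: "nat set set" and U :: "nat set" and F :: "nat set set"
  assumes card_edge: "e \<in> E \<Longrightarrow> card e = 3"
    and F_sub: "F \<subseteq> E"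
    and F_edges: "{u, v, w} \<in> E \<Longrightarrow> v \<in> U \<Longrightarrow> w \<in> U \<Longrightarrow> {u, v, w} \<in> F"
    and forest: "hyperforest F"
begin

lemma prescribe:
  assumes "u = w \<Longrightarrow> c = d"
    and "c \<Longrightarrow> d \<Longrightarrow> u \<noteq> w \<Longrightarrow> \<not> (\<exists>e\<in>F. u \<in> e \<and> w \<in> e)"
  obtains A where "exact_hitting F A" "u \<in> A \<longleftrightarrow> c" "w \<in> A \<longleftrightarrow> d"
  using hyperforest_two_point_extension[OF forest, of u w c d] assms by blast

lemma prescribe1:
  obtains A where "exact_hitting F A" "u \<in> A \<longleftrightarrow> c"
  using prescribe[of u u c c] by blast

text \<open>
  For each non-numeric element other than \<open>Full\<close> and \<open>Inf\<close>, being hit is the status of a single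
  vertex (\<open>v\<close> chosen for \<open>Vert v\<close>, not chosen for \<open>Co v\<close>), so prescribing two vertices is enough to
  separate two elements. For \<open>Vert v\<close> against \<open>Co w\<close> both vertices are left out, which is possible
  also for adjacent vertices.
\<close>
lemma separates:
  assumes "x \<noteq> y" "x \<noteq> Inf" "y \<noteq> Inf"
  shows "\<exists>A. exact_hitting F A \<and> hval A x \<noteq> hval A y"
proof -
  have lit: "\<exists>A. exact_hitting F A \<and> (v \<in> A \<longleftrightarrow> c) \<and> (w \<in> A \<longleftrightarrow> \<not> c)" if "v \<noteq> w" for v w c
    using prescribe[of v w c "\<not> c"] that by metis
  have same: "\<exists>A. exact_hitting F A \<and> v \<notin> A \<and> w \<notin> A" for v w
    using prescribe[of v w False False] by metis
  have one: "\<exists>A. exact_hitting F A \<and> (v \<in> A \<longleftrightarrow> c)" for v c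
    using prescribe1[of v c] by metis
  have any: "\<exists>A. exact_hitting F A" using one by blast
  show ?thesis
  proof (cases x)
    case x: (Vert v)
    show ?thesis
    proof (cases y)
      case (Vert w)
      then show ?thesis using lit[of v w True] assms(1) x by auto
    next
      case (Co w)
      then show ?thesis using same[of v w] x by auto
    next
      case Full
      then show ?thesis using one[of v False] x by auto
    next
      case N2
      then show ?thesis using one[of v True] x by auto
    qed (use any assms x in auto)
  next
    case x: (Co v)
    show ?thesis
    proof (cases y)
      case (Vert w)
      then show ?thesis using same[of v w] x by auto
    next
      case (Co w)
      then show ?thesis using lit[of v w True] assms(1) x by auto
    next
      case Full
      then show ?thesis using one[of v True] x by auto
    next
      case N2
      then show ?thesis using one[of v False] x by auto
    qed (use any assms x in auto)
  next
    case x: Full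
    show ?thesis
    proof (cases y)
      case (Vert w)
      then show ?thesis using one[of w False] x by auto
    next
      case (Co w)
      then show ?thesis using one[of w True] x by auto
    qed (use any assms x in auto)
  next
    case x: N2
    show ?thesis
    proof (cases y)
      case (Vert w)
      then show ?thesis using one[of w True] x by auto
    next
      case (Co w)
      then show ?thesis using one[of w False] x by auto
    qed (use any assms x in auto)
  next
    case N0
    then show ?thesis using any assms by (cases y) auto
  next
    case N1
    then show ?thesis using any assms by (cases y) auto
  qed (use assms in simp)
qed

lemma high:
  assumes "m \<notin> numeric" "represents F m b"
  obtains A where "exact_hitting F A" "b A \<in> {Ba, Binf}"
proof (cases "m = Inf")
  case True
  then show ?thesis using assms(2) that by (auto simp: represents_def)
next
  case False
  obtain A where A: "exact_hitting F A" "hval A N2 \<noteq> hval A m"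
    using separates[of N2 m] assms(1) False by auto
  have "b A = hval A m" using assms(2) A(1) False by (auto simp: represents_def tracks_def)
  moreover have "hval A m \<in> {B2, Ba}" using assms(1) False by (cases m) auto
  ultimately show ?thesis using A that by auto
qed

text \<open>
  The product of two elements was defined to be different from \<open>Inf\<close> only where exactness of the
  edges forbids that both factors are hit. In all other cases two prescriptions hit both factors,
  and then the product in \<open>B\<close> is \<open>Binf\<close>.
\<close>
lemma both_high:
  assumes "x \<notin> numeric" "y \<notin> numeric" "x \<noteq> Inf" "y \<noteq> Inf" "h_mul E x y = Inf"
    and U: "\<And>v. x = Vert v \<Longrightarrow> v \<in> U" "\<And>v. y = Vert v \<Longrightarrow> v \<in> U"
  shows "\<exists>A. exact_hitting F A \<and> hval A x = Ba \<and> hval A y = Ba"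
proof -
  have one: "\<exists>A. exact_hitting F A \<and> (v \<in> A \<longleftrightarrow> c)" for v c
    using prescribe1[of v c] by metis
  have any: "\<exists>A. exact_hitting F A" using one by blast
  have vc: "\<exists>A. exact_hitting F A \<and> v \<in> A \<and> u \<notin> A" if "v \<noteq> u" for v u
    using prescribe[of v u True False] that by metis
  have cc: "\<exists>A. exact_hitting F A \<and> v \<notin> A \<and> w \<notin> A" for v w
    using prescribe[of v w False False] by metis
  have vv: "\<exists>A. exact_hitting F A \<and> v \<in> A \<and> w \<in> A"
    if "v = w \<or> (\<forall>u. {u, v, w} \<notin> E)" for v w
  proof -
    have "\<not> (\<exists>e\<in>F. v \<in> e \<and> w \<in> e)" if "v \<noteq> w"
    proof
      assume "\<exists>e\<in>F. v \<in> e \<and> w \<in> e"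
      then obtain e where e: "e \<in> E" "v \<in> e" "w \<in> e" using F_sub by blast
      then obtain a b c where abc: "e = {a, b, c}" using card_edge by (metis card_3_iff)
      have "e = {a, v, w} \<or> e = {b, v, w} \<or> e = {c, v, w}"
        using e(2,3) \<open>v \<noteq> w\<close> unfolding abc by (auto simp: insert_commute)
      then show False using e(1) \<open>v = w \<or> _\<close> \<open>v \<noteq> w\<close> by blast
    qed
    then show ?thesis using prescribe[of v w True True] by metis
  qed
  show ?thesis
  proof (cases x)
    case x: (Vert v)
    show ?thesis
    proof (cases y)
      case (Vert w)
      then have "v = w \<or> (\<forall>u. {u, v, w} \<notin> E)" using assms(5) x by (auto simp: h_mul_def split: if_splits)
      then show ?thesis using vv[of v w] x Vert by auto
    next
      case (Co w)
      then have "v \<noteq> w" using assms(5) x by (auto simp: h_mul_def)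
      then show ?thesis using vc[of v w] x Co by auto
    qed (use assms x one[of v True] in auto)
  next
    case x: (Co v)
    show ?thesis
    proof (cases y)
      case (Vert w)
      then have "v \<noteq> w" using assms(5) x by (auto simp: h_mul_def)
      then show ?thesis using vc[of w v] x Vert by auto
    next
      case (Co w)
      then show ?thesis using cc[of v w] x by auto
    qed (use assms x one[of v False] in auto)
  next
    case x: Full
    show ?thesis
    proof (cases y)
      case (Vert w)
      then show ?thesis using one[of w True] x by auto
    next
      case (Co w)
      then show ?thesis using one[of w False] x by auto
    qed (use assms x any in auto)
  qed (use assms in auto)
qed

lemma rep_values:
  assumes "represents F m b" "exact_hitting F A"
  shows "m \<notin> numeric \<Longrightarrow> b A \<in> {B2, Ba, Binf}" "m \<in> numeric \<Longrightarrow> b A = hval A m"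
    "m \<noteq> Inf \<Longrightarrow> b A = hval A m"
proof -
  have "tracks A m (b A)" using assms by (simp add: represents_def)
  then show "m \<notin> numeric \<Longrightarrow> b A \<in> {B2, Ba, Binf}" "m \<in> numeric \<Longrightarrow> b A = hval A m"
    "m \<noteq> Inf \<Longrightarrow> b A = hval A m"
    by (cases m; cases "b A"; auto simp: tracks_def split: if_splits)+
qed

lemma representsI:
  assumes "\<And>A. exact_hitting F A \<Longrightarrow> tracks A m (b A)"
    and "m = Inf \<Longrightarrow> \<exists>A. exact_hitting F A \<and> b A = Binf"
  shows "represents F m b"
  using assms by (simp add: represents_def)

lemma represents_tracks:
  "represents F m b \<Longrightarrow> exact_hitting F A \<Longrightarrow> tracks A m (b A)"
  by (simp add: represents_def)

lemma represents_Inf: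
  assumes "represents F Inf b"
  obtains A where "exact_hitting F A" "b A = Binf"
  using assms by (auto simp: represents_def)

lemma represents_op1:
  assumes x: "represents F x a"
  shows "represents F (h_op1 f x) (\<lambda>A. b_op1 f (a A))"
proof -
  have "\<exists>A. exact_hitting F A \<and> b_op1 f (a A) = Binf" if "h_op1 f x = Inf"
  proof -
    have "x \<notin> numeric" using that by (cases f) (auto split: if_splits)
    then obtain A where "exact_hitting F A" "a A \<in> {Ba, Binf}" using high x by blast
    then show ?thesis by (cases f) auto
  qed
  then show ?thesis using representsI[OF tracks_op1[OF represents_tracks[OF x]]] by blast
qed

lemma represents_add:
  assumes x: "represents F x a" and y: "represents F y b"
  shows "represents F (h_add x y) (\<lambda>A. b_op2 Add (a A) (b A))"
proof -
  have "\<exists>A. exact_hitting F A \<and> b_op2 Add (a A) (b A) = Binf" if inf: "h_add x y = Inf"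
  proof -
    consider "x = Inf" | "y = Inf" | "x \<noteq> Inf" "y \<noteq> Inf" by blast
    then show ?thesis
    proof cases
      case 1
      then obtain A where A: "exact_hitting F A" "a A = Binf" using x represents_Inf by blast
      then show ?thesis by (intro exI[of _ A]) (cases "b A"; simp)
    next
      case 2
      then obtain A where A: "exact_hitting F A" "b A = Binf" using y represents_Inf by blast
      then show ?thesis by (intro exI[of _ A]) (cases "a A"; simp)
    next
      case 3
      then have ne: "x \<noteq> y" "x \<noteq> N0" "y \<noteq> N0" "x \<notin> numeric \<or> y \<notin> numeric"
        using inf by (auto simp: h_add_def split: if_splits)
      consider "x \<in> numeric" "y \<notin> numeric" | "y \<in> numeric" "x \<notin> numeric" | "x \<notin> numeric" "y \<notin> numeric"
        using ne(4) by blast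
      then show ?thesis
      proof cases
        case 1
        then obtain A where A: "exact_hitting F A" "b A \<in> {Ba, Binf}" using high y by blast
        moreover have "a A \<in> {B1, B2}" using rep_values(2)[OF x A(1)] 1 ne by auto
        ultimately show ?thesis by auto
      next
        case 2
        then obtain A where A: "exact_hitting F A" "a A \<in> {Ba, Binf}" using high x by blast
        moreover have "b A \<in> {B1, B2}" using rep_values(2)[OF y A(1)] 2 ne by auto
        ultimately show ?thesis by auto
      next
        case n: 3
        obtain A where A: "exact_hitting F A" "hval A x \<noteq> hval A y" using separates[OF ne(1) 3] by blast
        then have "a A \<noteq> b A" "a A \<in> {B2, Ba, Binf}" "b A \<in> {B2, Ba, Binf}"
          using rep_values[OF x A(1)] rep_values[OF y A(1)] 3 n by auto
        then show ?thesis using A(1) by auto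
      qed
    qed
  qed
  then show ?thesis
    using representsI[OF tracks_add[OF represents_tracks[OF x] represents_tracks[OF y]]] by blast
qed

lemma represents_mul:
  assumes x: "represents F x a" and y: "represents F y b"
    and U: "\<And>v. x = Vert v \<Longrightarrow> v \<in> U" "\<And>v. y = Vert v \<Longrightarrow> v \<in> U"
  shows "represents F (h_mul E x y) (\<lambda>A. b_op2 Mul (a A) (b A))"
proof -
  have "\<exists>A. exact_hitting F A \<and> b_op2 Mul (a A) (b A) = Binf" if inf: "h_mul E x y = Inf"
  proof -
    have ne: "x \<noteq> N0" "y \<noteq> N0" using inf by (auto simp: h_mul_def)
    consider "x = Inf" | "y = Inf" | "x \<noteq> Inf" "y \<noteq> Inf" by blast
    then show ?thesis
    proof cases
      case 1
      then obtain A where A: "exact_hitting F A" "a A = Binf" using x represents_Inf by blast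
      have "b A \<noteq> B0" using rep_values(1,2)[OF y A(1)] ne by (cases "y \<in> numeric") auto
      then show ?thesis using A by (intro exI[of _ A]) (cases "b A"; simp)
    next
      case 2
      then obtain A where A: "exact_hitting F A" "b A = Binf" using y represents_Inf by blast
      have "a A \<noteq> B0" using rep_values(1,2)[OF x A(1)] ne by (cases "x \<in> numeric") auto
      then show ?thesis using A by (intro exI[of _ A]) (cases "a A"; simp)
    next
      case 3
      then have "x \<notin> numeric" "y \<notin> numeric" using inf by (auto simp: h_mul_def split: if_splits)
      then obtain A where A: "exact_hitting F A" "hval A x = Ba" "hval A y = Ba"
        using both_high[of x y] 3 inf U by auto
      then show ?thesis using rep_values(3)[OF x A(1)] rep_values(3)[OF y A(1)] 3 by auto
    qed
  qed
  moreover have "tracks A (h_mul E x y) (b_op2 Mul (a A) (b A))" if A: "exact_hitting F A" for A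
  proof (rule tracks_mul)
    fix u v w assume e: "x = Vert v" "y = Vert w" "{u, v, w} \<in> E" "v \<noteq> w"
    then have "card {u, v, w} = 3" using card_edge by blast
    then have "u \<notin> {v, w}" using e(4) by (auto simp: insert_absorb)
    moreover have "{u, v, w} \<in> F" using F_edges e U by blast
    ultimately show "u \<notin> {v, w} \<and> (\<exists>z. {u, v, w} \<inter> A = {z})" using A by (simp add: exact_hitting_def)
  qed (use x y A in \<open>auto simp: represents_def\<close>)
  ultimately show ?thesis by (simp add: represents_def)
qed

lemma represents_exp:
  assumes x: "represents F x a" and y: "represents F y b"
  shows "represents F (h_exp x y) (\<lambda>A. b_op2 Exp (a A) (b A))"
proof -
  have "\<exists>A. exact_hitting F A \<and> b_op2 Exp (a A) (b A) = Binf" if inf: "h_exp x y = Inf"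
  proof -
    have ne: "y \<noteq> N0" "x \<noteq> N0" "x \<noteq> N1" using inf by (auto simp: h_exp_def split: if_splits)
    consider "y = N1" "x = Inf" | "y \<noteq> N1" "x \<notin> numeric" | "x = N2" "y \<notin> numeric"
      using inf ne by (auto simp: h_exp_def split: if_splits)
    then show ?thesis
    proof cases
      case 1
      then obtain A where A: "exact_hitting F A" "a A = Binf" using x represents_Inf by blast
      then show ?thesis using rep_values(2)[OF y A(1)] 1 by (intro exI[of _ A]) simp
    next
      case 2
      then obtain A where A: "exact_hitting F A" "a A \<in> {Ba, Binf}" using high x by blast
      have "b A \<in> {B2, Ba, Binf}" using rep_values(1,2)[OF y A(1)] 2 ne by (cases "y = N2") auto
      then show ?thesis using A by (intro exI[of _ A]) auto
    next
      case 3
      then obtain A where A: "exact_hitting F A" "b A \<in> {Ba, Binf}" using high y by blast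
      then show ?thesis using rep_values(2)[OF x A(1)] 3 by (intro exI[of _ A]) auto
    qed
  qed
  then show ?thesis
    using representsI[OF tracks_exp[OF represents_tracks[OF x] represents_tracks[OF y]]] by blast
qed

lemma represents_binom:
  assumes x: "represents F x a" and y: "represents F y b"
  shows "represents F (h_binom x y) (\<lambda>A. b_op2 Binom (a A) (b A))"
proof -
  have "\<exists>A. exact_hitting F A \<and> b_op2 Binom (a A) (b A) = Binf" if inf: "h_binom x y = Inf"
  proof -
    have ne: "y \<noteq> N0" "x \<noteq> N0" using inf by (auto simp: h_binom_def split: if_splits)
    consider "x \<notin> numeric" | "y \<notin> numeric"
      using inf ne by (auto simp: h_binom_def split: if_splits)
    then show ?thesis
    proof cases
      case 1
      then obtain A where A: "exact_hitting F A" "a A \<in> {Ba, Binf}" using high x by blast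
      have "b A \<noteq> B0" using rep_values(1,2)[OF y A(1)] ne by (cases "y \<in> numeric") auto
      then show ?thesis using A by (intro exI[of _ A]) (cases "b A"; auto)
    next
      case 2
      then obtain A where A: "exact_hitting F A" "b A \<in> {Ba, Binf}" using high y by blast
      have "a A \<noteq> B0" using rep_values(1,2)[OF x A(1)] ne by (cases "x \<in> numeric") auto
      then show ?thesis using A by (intro exI[of _ A]) (cases "a A"; auto)
    qed
  qed
  then show ?thesis
    using representsI[OF tracks_binom[OF represents_tracks[OF x] represents_tracks[OF y]]] by blast
qed

end

primrec vars :: "trm \<Rightarrow> nat set" where
  "vars (Var n) = {n}"
| "vars (App0 f) = {}"
| "vars (App1 f s) = vars s"
| "vars (App2 f s t) = vars s \<union> vars t"

lemma finite_vars: "finite (vars t)"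
  by (induction t) auto

context acyclic_patch
begin

text \<open>
  The second conjunct is the invariant needed for multiplication: only the elements \<open>Vert v\<close> assigned
  to variables ever occur.
\<close>
lemma represents_eval:
  assumes "\<forall>n\<in>vars t. \<forall>v. \<phi> n = Vert v \<longrightarrow> v \<in> U"
  shows "represents F (eval (hyp_alg E) \<phi> t) (\<lambda>A. eval alg_B (\<lambda>n. hval A (\<phi> n)) t) \<and>
    (\<forall>v. eval (hyp_alg E) \<phi> t = Vert v \<longrightarrow> v \<in> U)"
  using assms
proof (induction t)
  case (Var n)
  obtain A where "exact_hitting F A" using prescribe1[of 0 True] by blast
  then have "represents F (\<phi> n) (\<lambda>A. hval A (\<phi> n))"
    by (intro representsI exI[of _ A]) (auto simp: tracks_def)
  then show ?case using Var by simp
next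
  case (App0 f)
  show ?case
    by (cases f) (auto simp: hyp_alg_def alg_B_def represents_def tracks_def)
next
  case (App1 f s)
  then have "represents F (eval (hyp_alg E) \<phi> s) (\<lambda>A. eval alg_B (\<lambda>n. hval A (\<phi> n)) s)" by simp
  from represents_op1[OF this, of f]
  have "represents F (eval (hyp_alg E) \<phi> (App1 f s)) (\<lambda>A. eval alg_B (\<lambda>n. hval A (\<phi> n)) (App1 f s))"
    by (simp add: hyp_alg_def alg_B_def)
  moreover have "eval (hyp_alg E) \<phi> (App1 f s) \<noteq> Vert v" for v
    by (cases f) (auto simp: hyp_alg_def)
  ultimately show ?case by blast
next
  case (App2 f s t)
  have vs: "\<forall>n\<in>vars s. \<forall>v. \<phi> n = Vert v \<longrightarrow> v \<in> U" and vt: "\<forall>n\<in>vars t. \<forall>v. \<phi> n = Vert v \<longrightarrow> v \<in> U"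
    using App2.prems by auto
  define x where "x = eval (hyp_alg E) \<phi> s"
  define y where "y = eval (hyp_alg E) \<phi> t"
  define a where "a = (\<lambda>A. eval alg_B (\<lambda>n. hval A (\<phi> n)) s)"
  define b where "b = (\<lambda>A. eval alg_B (\<lambda>n. hval A (\<phi> n)) t)"
  have x: "represents F x a" "\<And>v. x = Vert v \<Longrightarrow> v \<in> U"
    using App2.IH(1)[OF vs] by (simp_all add: x_def a_def)
  have y: "represents F y b" "\<And>v. y = Vert v \<Longrightarrow> v \<in> U"
    using App2.IH(2)[OF vt] by (simp_all add: y_def b_def)
  have "represents F (h_op2 E f x y) (\<lambda>A. b_op2 f (a A) (b A))"
  proof (cases f)
    case Add
    then show ?thesis using represents_add[OF x(1) y(1)] by simp
  next
    case Mul
    then show ?thesis using represents_mul[OF x(1) y(1) x(2) y(2)] by simp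
  next
    case Exp
    then show ?thesis using represents_exp[OF x(1) y(1)] by simp
  next
    case Binom
    then show ?thesis using represents_binom[OF x(1) y(1)] by simp
  qed
  moreover have "v \<in> U" if "h_op2 E f x y = Vert v" for v
  proof -
    have "x = Vert v \<or> y = Vert v"
    proof (cases f)
      case Mul
      then show ?thesis using that by (auto simp: h_mul_def split: if_splits melem.splits)
    qed (use that in \<open>auto simp: h_add_def h_exp_def h_binom_def split: if_splits\<close>)
    then show ?thesis using x(2) y(2) by blast
  qed
  ultimately show ?case by (simp add: x_def y_def a_def b_def hyp_alg_def alg_B_def)
qed

text \<open>
  An equation that holds in all shadows holds in the hypergraph algebra: a value \<open>Inf\<close> on one side
  only is betrayed by some shadow \<open>Binf\<close>, and two different values other than \<open>Inf\<close> have different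
  shadows.
\<close>
lemma eval_eq_transfer:
  assumes "\<forall>n\<in>vars s \<union> vars t. \<forall>v. \<phi> n = Vert v \<longrightarrow> v \<in> U"
    and B: "\<And>A. eval alg_B (\<lambda>n. hval A (\<phi> n)) s = eval alg_B (\<lambda>n. hval A (\<phi> n)) t"
  shows "eval (hyp_alg E) \<phi> s = eval (hyp_alg E) \<phi> t"
proof -
  define x where "x = eval (hyp_alg E) \<phi> s"
  define y where "y = eval (hyp_alg E) \<phi> t"
  define a where "a = (\<lambda>A. eval alg_B (\<lambda>n. hval A (\<phi> n)) s)"
  have "\<forall>n\<in>vars s. \<forall>v. \<phi> n = Vert v \<longrightarrow> v \<in> U" "\<forall>n\<in>vars t. \<forall>v. \<phi> n = Vert v \<longrightarrow> v \<in> U"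
    using assms(1) by auto
  then have x: "represents F x a" and y: "represents F y a"
    using represents_eval[of s \<phi>] represents_eval[of t \<phi>] by (simp_all add: x_def y_def a_def B)
  have fin: "hval A z \<noteq> Binf" if "z \<noteq> Inf" for A z using that by (cases z) auto
  have "x = y"
  proof (rule ccontr)
    assume ne: "x \<noteq> y"
    consider "x = Inf" "y \<noteq> Inf" | "y = Inf" "x \<noteq> Inf" | "x \<noteq> Inf" "y \<noteq> Inf" using ne by blast
    then show False
    proof cases
      case 1
      then obtain A where "exact_hitting F A" "a A = Binf" using represents_Inf x by blast
      then show False using rep_values(3)[OF y] 1(2) fin by metis
    next
      case 2
      then obtain A where "exact_hitting F A" "a A = Binf" using represents_Inf y by blast
      then show False using rep_values(3)[OF x] 2(2) fin by metis
    next
      case 3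
      obtain A where "exact_hitting F A" "hval A x \<noteq> hval A y" using separates[OF ne 3] by blast
      then show False using rep_values(3)[OF x] rep_values(3)[OF y] 3 by metis
    qed
  qed
  then show ?thesis by (simp add: x_def y_def)
qed

end

text \<open>
  The degree bounds the number of edges that meet \<open>U\<close>, and with it the length of the cycles that have
  to be excluded.
\<close>
lemma patch_of_cubic:
  assumes "cubic E" "cycle_free_upto (3 * n) E" "finite U" "card U \<le> n"
  shows "acyclic_patch E U {e\<in>E. e \<inter> U \<noteq> {}}"
proof
  show "e \<in> E \<Longrightarrow> card e = 3" for e using assms(1) by (simp add: cubic_def)
  show "{u, v, w} \<in> E \<Longrightarrow> v \<in> U \<Longrightarrow> w \<in> U \<Longrightarrow> {u, v, w} \<in> {e\<in>E. e \<inter> U \<noteq> {}}" for u v w by blast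
  have deg: "card {e\<in>E. x \<in> e} \<le> 3" for x
  proof (cases "x \<in> \<Union>E")
    case True
    then show ?thesis using assms(1) unfolding cubic_def by (metis order.refl)
  next
    case False
    then have "{e\<in>E. x \<in> e} = {}" by blast
    then show ?thesis by (simp only: card.empty)
  qed
  have "{e\<in>E. e \<inter> U \<noteq> {}} = (\<Union>x\<in>U. {e\<in>E. x \<in> e})" by blast
  also have "card \<dots> \<le> (\<Sum>x\<in>U. card {e\<in>E. x \<in> e})" by (rule card_UN_le[OF assms(3)])
  also have "\<dots> \<le> (\<Sum>x\<in>U. 3)" by (rule sum_mono) (rule deg)
  also have "\<dots> \<le> 3 * n" using assms(4) by simp
  finally have "card {e\<in>E. e \<inter> U \<noteq> {}} \<le> 3 * n" .
  then show "hyperforest {e\<in>E. e \<inter> U \<noteq> {}}"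
    using assms(1,2) by (intro cycle_free_imp_hyperforest[of "3 * n" E]) (auto simp: cubic_def)
qed blast

text \<open>
  The two admitted pairs of carriers are those with zero and those without; shadows of nonzero
  elements are nonzero, so both cases run in parallel.
\<close>
lemma hyp_alg_satisfies_small:
  assumes E: "cubic E" "cycle_free_upto (3 * n) E"
    and small: "card (vars s \<union> vars t) \<le> n"
    and CD: "(C, D) \<in> {(UNIV, UNIV), (- {N0}, - {B0})}"
    and sat: "satisfies (alg_B\<lparr>carrier := D\<rparr>) (s, t)"
  shows "satisfies ((hyp_alg E)\<lparr>carrier := C\<rparr>) (s, t)"
  unfolding satisfies_def
proof (intro allI impI)
  fix \<phi> :: "nat \<Rightarrow> melem"
  assume \<phi>: "range \<phi> \<subseteq> carrier ((hyp_alg E)\<lparr>carrier := C\<rparr>)"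
  define U where "U = (\<lambda>n. case \<phi> n of Vert v \<Rightarrow> v | _ \<Rightarrow> 0) ` (vars s \<union> vars t)"
  have "finite U" by (simp add: U_def finite_vars)
  moreover have "card U \<le> n"
    unfolding U_def using small by (meson card_image_le finite_UnI finite_vars order.trans)
  ultimately interpret acyclic_patch E U "{e\<in>E. e \<inter> U \<noteq> {}}" by (rule patch_of_cubic[OF E])
  have "eval (hyp_alg E) \<phi> s = eval (hyp_alg E) \<phi> t"
  proof (rule eval_eq_transfer)
    have "v \<in> U" if "n \<in> vars s \<union> vars t" "\<phi> n = Vert v" for n v
      unfolding U_def using that by (intro image_eqI[of _ _ n]) simp_all
    then show "\<forall>n\<in>vars s \<union> vars t. \<forall>v. \<phi> n = Vert v \<longrightarrow> v \<in> U" by blast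
  next
    fix A
    have "hval A x \<noteq> B0" if "x \<noteq> N0" for x using that by (cases x) auto
    then have "range (\<lambda>n. hval A (\<phi> n)) \<subseteq> D" using \<phi> CD by auto
    then show "eval alg_B (\<lambda>n. hval A (\<phi> n)) s = eval alg_B (\<lambda>n. hval A (\<phi> n)) t"
      using sat by (simp add: satisfies_def)
  qed
  then show "eval ((hyp_alg E)\<lparr>carrier := C\<rparr>) \<phi> (fst (s, t)) = eval ((hyp_alg E)\<lparr>carrier := C\<rparr>) \<phi> (snd (s, t))"
    by simp
qed

section \<open>An equation of B that fails in the hypergraph algebra\<close>

definition prod_term :: "nat list \<Rightarrow> trm" where
  "prod_term xs = foldr (\<lambda>x t. App2 Mul (Var x) t) xs (App0 One)"

text \<open>
  The sum starts from a monomial \<open>l\<close> that also occurs in \<open>ls\<close> in all later uses: there is no empty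
  sum in the signatures without zero, and the repetition ensures that the value is \<open>B2\<close> rather than
  \<open>B1\<close> when all variables are \<open>B1\<close>.
\<close>
definition edge_sum :: "nat list \<Rightarrow> nat list list \<Rightarrow> trm" where
  "edge_sum l ls = foldr (\<lambda>l t. App2 Add (prod_term l) t) ls (prod_term l)"

text \<open>
  Squaring the product of all variables gives a summand that is \<open>Inf\<close> in the hypergraph algebra,
  because no non-numeric element has a square different from \<open>Inf\<close>.
\<close>
definition hitting_equation :: "nat list \<Rightarrow> nat list list \<Rightarrow> nat list \<Rightarrow> equation" where
  "hitting_equation l ls xs =
     (edge_sum l ls, App2 Add (edge_sum l ls) (App2 Mul (prod_term xs) (prod_term xs)))"

lemma opsyms_prod_term: "opsyms (prod_term xs) \<subseteq> {Binary Mul, Nullary One}"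
  by (induction xs) (auto simp: prod_term_def)

lemma opsyms_edge_sum: "opsyms (edge_sum l ls) \<subseteq> {Binary Add, Binary Mul, Nullary One}"
proof (induction ls)
  case Nil
  then show ?case using opsyms_prod_term[of l] by (auto simp: edge_sum_def)
next
  case (Cons k ls)
  then show ?case using opsyms_prod_term[of k] by (auto simp: edge_sum_def)
qed

lemma hitting_equation_in_equations:
  "{Binary Add, Binary Mul, Nullary One} \<subseteq> \<tau> \<Longrightarrow> hitting_equation l ls xs \<in> equations \<tau>"
  using opsyms_edge_sum[of l ls] opsyms_prod_term[of xs]
  by (auto simp: equations_def terms_def hitting_equation_def)

lemma prod_term_zero:
  assumes "x \<in> set xs" "\<psi> x = B0"
  shows "eval alg_B \<psi> (prod_term xs) = B0"
  using assms
proof (induction xs)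
  case (Cons y ys)
  have z: "b_op2 Mul b B0 = B0" "b_op2 Mul B0 b = B0" for b by (cases b; simp)+
  show ?case using Cons z by (auto simp: prod_term_def alg_B_def simp del: b_op2.simps)
qed simp

text \<open>
  Without zeros, a product of distinct variables is \<open>Binf\<close> as soon as some variable is \<open>Binf\<close> or two
  of them are \<open>Ba\<close>.
\<close>
lemma prod_term_nonzero:
  assumes "distinct xs" "\<And>x. x \<in> set xs \<Longrightarrow> \<psi> x \<noteq> B0"
  defines "b \<equiv> eval alg_B \<psi> (prod_term xs)"
  shows "b \<noteq> B0 \<and> (b \<noteq> Binf \<longrightarrow> Binf \<notin> \<psi> ` set xs \<and>
    (b = Ba \<longrightarrow> (\<exists>x. set xs \<inter> {x. \<psi> x = Ba} = {x})) \<and>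
    (b \<noteq> Ba \<longrightarrow> set xs \<inter> {x. \<psi> x = Ba} = {}))"
  using assms(1,2) unfolding b_def
proof (induction xs)
  case Nil
  then show ?case by (simp add: prod_term_def alg_B_def)
next
  case (Cons y ys)
  define c where "c = eval alg_B \<psi> (prod_term ys)"
  have ev: "eval alg_B \<psi> (prod_term (y # ys)) = b_op2 Mul (\<psi> y) c"
    by (simp add: c_def prod_term_def alg_B_def)
  have IH: "c \<noteq> B0" "c \<noteq> Binf \<Longrightarrow> Binf \<notin> \<psi> ` set ys"
    "c = Ba \<Longrightarrow> \<exists>x. set ys \<inter> {x. \<psi> x = Ba} = {x}"
    "c \<in> {B1, B2} \<Longrightarrow> set ys \<inter> {x. \<psi> x = Ba} = {}"
    using Cons by (auto simp: c_def)
  have y: "\<psi> y \<noteq> B0" "y \<notin> set ys" using Cons.prems by auto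
  show ?case
  proof (cases "\<psi> y")
    case Ba
    then have "set (y # ys) \<inter> {x. \<psi> x = Ba} = insert y (set ys \<inter> {x. \<psi> x = Ba})" by auto
    then show ?thesis using IH Ba unfolding ev by (cases c) auto
  next
    case B1
    then have "set (y # ys) \<inter> {x. \<psi> x = Ba} = set ys \<inter> {x. \<psi> x = Ba}" by auto
    then show ?thesis using IH B1 unfolding ev by (cases c) auto
  next
    case B2
    then have "set (y # ys) \<inter> {x. \<psi> x = Ba} = set ys \<inter> {x. \<psi> x = Ba}" by auto
    then show ?thesis using IH B2 unfolding ev by (cases c) auto
  next
    case Binf
    then show ?thesis using IH(1) unfolding ev by (cases c) auto
  qed (use y in simp)
qed

text \<open>
  In \<open>B\<close>, the sum of \<open>Ba\<close> and a nonzero element other than \<open>Ba\<close> is \<open>Binf\<close>, so a finite value forces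
  the monomials to be all hit or all unhit.
\<close>
lemma edge_sum_nonzero:
  assumes "\<And>k. k \<in> insert l (set ls) \<Longrightarrow> eval alg_B \<psi> (prod_term k) \<noteq> B0"
  defines "b \<equiv> eval alg_B \<psi> (edge_sum l ls)"
  shows "b = Binf \<or>
    b = Ba \<and> (\<forall>k\<in>insert l (set ls). eval alg_B \<psi> (prod_term k) = Ba) \<or>
    b \<in> {B1, B2} \<and> (ls \<noteq> [] \<longrightarrow> b = B2) \<and>
      (\<forall>k\<in>insert l (set ls). eval alg_B \<psi> (prod_term k) \<in> {B1, B2})"
  using assms(1) unfolding b_def
proof (induction ls)
  case Nil
  then show ?case by (cases "eval alg_B \<psi> (prod_term l)") (auto simp: edge_sum_def)
next
  case (Cons k ks)
  define c where "c = eval alg_B \<psi> (edge_sum l ks)"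
  define d where "d = eval alg_B \<psi> (prod_term k)"
  have ev: "eval alg_B \<psi> (edge_sum l (k # ks)) = b_op2 Add d c"
    by (simp add: c_def d_def edge_sum_def alg_B_def)
  have d: "d \<noteq> B0" using Cons.prems by (simp add: d_def)
  have "c = Binf \<or>
    c = Ba \<and> (\<forall>k\<in>insert l (set ks). eval alg_B \<psi> (prod_term k) = Ba) \<or>
    c \<in> {B1, B2} \<and> (\<forall>k\<in>insert l (set ks). eval alg_B \<psi> (prod_term k) \<in> {B1, B2})"
    using Cons unfolding c_def by auto
  then show ?case
  proof (elim disjE conjE)
    assume "c = Binf"
    then show ?thesis unfolding ev by (cases d) simp_all
  next
    assume "c = Ba" "\<forall>k\<in>insert l (set ks). eval alg_B \<psi> (prod_term k) = Ba"
    then show ?thesis unfolding ev using d d_def by (cases d) simp_all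
  next
    assume "c \<in> {B1, B2}" "\<forall>k\<in>insert l (set ks). eval alg_B \<psi> (prod_term k) \<in> {B1, B2}"
    then show ?thesis unfolding ev using d d_def by (cases d) auto
  qed
qed

text \<open>
  If some variable is zero, then so is the additional summand. Otherwise the sum over the edges is
  \<open>Binf\<close>, which absorbs every summand, or \<open>B2\<close>, which absorbs \<open>B1\<close> and \<open>B2\<close>; the remaining value
  \<open>Ba\<close> would make the variables with value \<open>Ba\<close> an exact hitting set.
\<close>
lemma hitting_equation_holds:
  assumes dist: "\<And>k. k \<in> set ls \<Longrightarrow> distinct k" "distinct xs"
    and sets: "set ` set ls = E" "set xs = \<Union>E" "l \<in> set ls"
    and no: "\<And>A. \<not> exact_hitting E A"
  shows "satisfies alg_B (hitting_equation l ls xs)"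
  unfolding satisfies_def
proof (intro allI impI)
  fix \<psi> :: "nat \<Rightarrow> b_elem"
  define t where "t = eval alg_B \<psi> (edge_sum l ls)"
  define w where "w = eval alg_B \<psi> (prod_term xs)"
  have "b_op2 Add t (b_op2 Mul w w) = t"
  proof (cases "\<exists>x\<in>set xs. \<psi> x = B0")
    case True
    then have "w = B0" unfolding w_def using prod_term_zero by blast
    then show ?thesis by (cases t) simp_all
  next
    case False
    have ins: "insert l (set ls) = set ls" using sets(3) by blast
    have cover: "set k \<subseteq> set xs" if "k \<in> set ls" for k using that sets(1,2) by blast
    have nz: "\<psi> x \<noteq> B0" if "k \<in> set ls" "x \<in> set k" for k x using cover that False by blast
    have P: "eval alg_B \<psi> (prod_term k) \<noteq> B0"
      "eval alg_B \<psi> (prod_term k) = Ba \<Longrightarrow> \<exists>x. set k \<inter> {x. \<psi> x = Ba} = {x}"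
      "eval alg_B \<psi> (prod_term k) \<in> {B1, B2} \<Longrightarrow>
        Binf \<notin> \<psi> ` set k \<and> set k \<inter> {x. \<psi> x = Ba} = {}" if "k \<in> set ls" for k
      using prod_term_nonzero[of k \<psi>, OF dist(1)[OF that] nz[OF that]] by auto
    have "t = Binf \<or>
      t = Ba \<and> (\<forall>k\<in>insert l (set ls). eval alg_B \<psi> (prod_term k) = Ba) \<or>
      t \<in> {B1, B2} \<and> (ls \<noteq> [] \<longrightarrow> t = B2) \<and>
        (\<forall>k\<in>insert l (set ls). eval alg_B \<psi> (prod_term k) \<in> {B1, B2})"
      unfolding t_def by (rule edge_sum_nonzero) (use P(1) ins in blast)
    then show ?thesis
    proof (elim disjE conjE)
      assume "t = Binf"
      then show ?thesis by (cases w) simp_all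
    next
      assume all: "\<forall>k\<in>insert l (set ls). eval alg_B \<psi> (prod_term k) = Ba"
      have "\<exists>x. e \<inter> {x. \<psi> x = Ba} = {x}" if e: "e \<in> E" for e
      proof -
        obtain k where "k \<in> set ls" "e = set k" using e sets(1) by blast
        then show ?thesis using P(2)[of k] all by simp
      qed
      then show ?thesis using no unfolding exact_hitting_def by blast
    next
      assume t: "ls \<noteq> [] \<longrightarrow> t = B2"
        and all: "\<forall>k\<in>insert l (set ls). eval alg_B \<psi> (prod_term k) \<in> {B1, B2}"
      have two: "t = B2" using t sets(3) by auto
      have x: "\<psi> x \<notin> {Ba, Binf}" if x: "x \<in> set xs" for x
      proof -
        obtain k where k: "k \<in> set ls" "x \<in> set k" using x sets(1,2) by blast
        have "eval alg_B \<psi> (prod_term k) \<in> {B1, B2}" using all k(1) by blast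
        then have "Binf \<notin> \<psi> ` set k" "set k \<inter> {x. \<psi> x = Ba} = {}" using P(3)[OF k(1)] by blast+
        then show ?thesis using k(2) by (metis (mono_tags, lifting) IntI emptyE image_eqI insertE mem_Collect_eq singletonD)
      qed
      have "\<psi> x \<in> {B1, B2}" if "x \<in> set xs" for x
        using x[OF that] False that by (cases "\<psi> x") auto
      then have "w \<in> {B1, B2}" unfolding w_def
      proof (induction xs)
        case (Cons y ys)
        have "eval alg_B \<psi> (prod_term (y # ys)) = b_op2 Mul (\<psi> y) (eval alg_B \<psi> (prod_term ys))"
          by (simp add: prod_term_def alg_B_def)
        then show ?case using Cons by fastforce
      qed (simp add: prod_term_def alg_B_def)
      then show ?thesis using two by auto
    qed
  qed
  then show "eval alg_B \<psi> (fst (hitting_equation l ls xs)) = eval alg_B \<psi> (snd (hitting_equation l ls xs))"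
    by (simp add: hitting_equation_def t_def w_def alg_B_def)
qed

text \<open>
  Under the tautological assignment all edges have the value \<open>Full\<close>, and \<open>Full\<close> is idempotent
  under addition, so the left-hand side is \<open>Full\<close>; the right-hand side is \<open>Inf\<close>. Two edges sharing
  two vertices would be a cycle of length 2, so the third vertex of an edge is determined.
\<close>
lemma hitting_equation_fails:
  assumes E: "cubic E" "cycle_free_upto 2 E"
    and ls: "\<And>k. k \<in> set ls \<Longrightarrow> distinct k \<and> set k \<in> E"
    and xs: "set xs = \<Union>E" "l \<in> set ls"
    and C: "N1 \<in> C" "\<And>v. Vert v \<in> C"
  shows "\<not> satisfies ((hyp_alg E)\<lparr>carrier := C\<rparr>) (hitting_equation l ls xs)"
proof
  define \<phi> where "\<phi> v = (if v \<in> \<Union>E then Vert v else N1)" for v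
  assume "satisfies ((hyp_alg E)\<lparr>carrier := C\<rparr>) (hitting_equation l ls xs)"
  moreover have "range \<phi> \<subseteq> C" using C by (auto simp: \<phi>_def)
  ultimately have eq: "eval (hyp_alg E) \<phi> (fst (hitting_equation l ls xs)) = eval (hyp_alg E) \<phi> (snd (hitting_equation l ls xs))"
    by (simp add: satisfies_def)
  have step: "eval (hyp_alg E) \<phi> (prod_term (y # ys)) = h_mul E (\<phi> y) (eval (hyp_alg E) \<phi> (prod_term ys))" for y ys
    by (simp add: prod_term_def hyp_alg_def)
  have nil: "eval (hyp_alg E) \<phi> (prod_term []) = N1" by (simp add: prod_term_def hyp_alg_def)
  have unique: "u = x" if "{u, y, z} \<in> E" "{x, y, z} \<in> E" "y \<noteq> z" for u x y z
  proof (rule ccontr)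
    assume "u \<noteq> x"
    have "card {u, y, z} = 3" "card {x, y, z} = 3" using E(1) that by (auto simp: cubic_def)
    then have n: "u \<notin> {y, z}" "x \<notin> {y, z}" using that(3) by (auto simp: card_insert_if split: if_splits)
    define F where "F = {{u, y, z}, {x, y, z}}"
    have ne: "{u, y, z} \<noteq> {x, y, z}" using n \<open>u \<noteq> x\<close> by blast
    have "F \<subseteq> E" "F \<noteq> {}" using that by (auto simp: F_def)
    moreover have "card F \<le> 2" unfolding F_def by (simp add: card_insert_if)
    ultimately obtain e where e: "e \<in> F" and leaf: "\<And>x y. shared F e x \<Longrightarrow> shared F e y \<Longrightarrow> x = y"
      using E(2) unfolding cycle_free_upto_def by metis
    have "shared F e y" "shared F e z" using e ne unfolding F_def shared_def by auto
    then show False using leaf that(3) by blast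
  qed
  have edge: "eval (hyp_alg E) \<phi> (prod_term k) = Full" if k: "k \<in> set ls" for k
  proof -
    have "card (set k) = 3" using ls[OF k] E(1) by (auto simp: cubic_def)
    then have "length k = 3" using ls[OF k] distinct_card by metis
    then obtain x y z where xyz: "k = [x, y, z]"
      by (auto simp: numeral_3_eq_3 length_Suc_conv)
    have e: "{x, y, z} \<in> E" and d: "y \<noteq> z" using ls[OF k] xyz by auto
    have "(SOME u. {u, y, z} \<in> E) = x"
      using unique[OF _ e d] e by (rule some_equality[rotated])
    moreover have "\<phi> x = Vert x" "\<phi> y = Vert y" "\<phi> z = Vert z"
      unfolding \<phi>_def using e by (metis UnionI insertCI)+
    moreover have "\<exists>u. {u, y, z} \<in> E" using e by blast
    ultimately show ?thesis unfolding xyz step nil using d by (simp add: h_mul_def)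
  qed
  have lhs: "eval (hyp_alg E) \<phi> (edge_sum l ks) = Full" if "set ks \<subseteq> set ls" for ks
    using that
  proof (induction ks)
    case Nil
    then show ?case using edge xs(2) by (simp add: edge_sum_def)
  next
    case (Cons k ks)
    then show ?case using edge[of k] by (simp add: edge_sum_def hyp_alg_def h_add_def)
  qed
  have prods: "eval (hyp_alg E) \<phi> (prod_term ys) \<notin> {N0, N2} \<and>
      (ys \<noteq> [] \<longrightarrow> eval (hyp_alg E) \<phi> (prod_term ys) \<noteq> N1)" if "set ys \<subseteq> \<Union>E" for ys
    using that
  proof (induction ys)
    case Nil
    then show ?case by (simp add: nil)
  next
    case (Cons y ys)
    then have "\<phi> y = Vert y" by (simp add: \<phi>_def)
    then show ?case using Cons unfolding step
      by (cases "eval (hyp_alg E) \<phi> (prod_term ys)") (auto simp: h_mul_def)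
  qed
  define w where "w = eval (hyp_alg E) \<phi> (prod_term xs)"
  have "set l \<in> E" "set l \<noteq> {}" using ls[OF xs(2)] E(1) by (auto simp: cubic_def)
  then have "xs \<noteq> []" using xs(1) by (metis Union_upper empty_set subset_empty)
  then have "w \<notin> numeric" using prods[of xs] xs(1) by (simp add: w_def)
  then have "h_mul E w w = Inf" by (cases w) (simp_all add: h_mul_def)
  then have "eval (hyp_alg E) \<phi> (snd (hitting_equation l ls xs)) = Inf"
    using lhs[of ls] by (simp add: hitting_equation_def hyp_alg_def h_add_def w_def)
  then show False using eq lhs[of ls] by (simp add: hitting_equation_def)
qed

lemma hyp_alg_is_algebra:
  assumes "C = UNIV \<or> C = - {N0} \<and> Nullary Zero \<notin> \<tau>"
  shows "is_algebra \<tau> ((hyp_alg E)\<lparr>carrier := C\<rparr>)"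
  using assms
proof
  assume C: "C = - {N0} \<and> Nullary Zero \<notin> \<tau>"
  have "h_op0 f \<noteq> N0" if "Nullary f \<in> \<tau>" for f using that C by (cases f) auto
  moreover have "h_op1 f x \<noteq> N0" for f x by (cases f) auto
  moreover have "h_op2 E f x y \<noteq> N0" if "x \<noteq> N0" "y \<noteq> N0" for f x y
    using that by (cases f) (auto simp: h_add_def h_mul_def h_exp_def h_binom_def split: melem.splits)
  ultimately show ?thesis using C by (auto simp: is_algebra_def hyp_alg_def)
qed (simp add: is_algebra_def hyp_alg_def)

lemma no_finite_axiomatisation:
  assumes \<tau>: "{Binary Add, Binary Mul, Nullary One} \<subseteq> \<tau>"
    and CD: "(C, D) \<in> {(UNIV, UNIV), (- {N0}, - {B0})}"
    and zero: "C = UNIV \<or> Nullary Zero \<notin> \<tau>"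
  shows "\<not> finitely_axiomatisable \<tau> (alg_B\<lparr>carrier := D\<rparr>)"
proof
  assume "finitely_axiomatisable \<tau> (alg_B\<lparr>carrier := D\<rparr>)"
  then obtain Ax where Ax: "finite Ax" "Ax \<subseteq> eq_theory \<tau> (alg_B\<lparr>carrier := D\<rparr>)"
    and ent: "\<And>e. e \<in> eq_theory \<tau> (alg_B\<lparr>carrier := D\<rparr>) \<Longrightarrow> entails \<tau> Ax e"
    unfolding finitely_axiomatisable_def by blast
  \<comment> \<open>Any bound for the number of variables will do; \<open>Suc\<close> also makes \<open>3 * n\<close> at least \<open>2\<close>.\<close>
  define n where "n = Suc (\<Sum>d\<in>Ax. card (vars (fst d) \<union> vars (snd d)))"
  obtain E :: "nat set set" where E: "cubic E" "cycle_free_upto (3 * n) E" "\<not> 3 dvd card E"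
    using exists_locally_acyclic_hypergraph by blast
  have "finite E" "finite (\<Union>E)" and fin: "\<And>e. e \<in> E \<Longrightarrow> finite e"
    using cubic_finite[OF E(1)] by auto
  obtain es where es: "set es = E" using finite_list \<open>finite E\<close> by blast
  define ls where "ls = map sorted_list_of_set es"
  define xs where "xs = sorted_list_of_set (\<Union>E)"
  have "E \<noteq> {}" using E(3) by auto
  then obtain l where l: "l \<in> set ls" using es by (cases es) (auto simp: ls_def)
  have k: "distinct k \<and> set k \<in> E" if "k \<in> set ls" for k
    using that es fin by (auto simp: ls_def)
  have sets: "set ` set ls = E" using es fin by (force simp: ls_def image_iff)
  have xs: "set xs = \<Union>E" "distinct xs" using \<open>finite (\<Union>E)\<close> by (simp_all add: xs_def)
  define e where "e = hitting_equation l ls xs"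
  have "satisfies alg_B e" unfolding e_def
    using k sets xs l cubic_no_exact_hitting[OF E(1,3)] by (intro hitting_equation_holds) auto
  then have "satisfies (alg_B\<lparr>carrier := D\<rparr>) e" by (simp add: satisfies_def)
  moreover have eq: "e \<in> equations \<tau>" unfolding e_def by (rule hitting_equation_in_equations[OF \<tau>])
  ultimately have "entails \<tau> Ax e" by (intro ent) (simp add: eq_theory_def)
  moreover have "Ax \<subseteq> equations \<tau>" using Ax(2) by (auto simp: eq_theory_def)
  moreover have "is_algebra \<tau> ((hyp_alg E)\<lparr>carrier := C\<rparr>)"
    by (rule hyp_alg_is_algebra) (use CD zero in auto)
  moreover have "satisfies ((hyp_alg E)\<lparr>carrier := C\<rparr>) d" if d: "d \<in> Ax" for d
  proof -
    have "card (vars (fst d) \<union> vars (snd d)) \<le> n"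
      unfolding n_def using member_le_sum[OF d, of "\<lambda>d. card (vars (fst d) \<union> vars (snd d))"] Ax(1) by simp
    moreover have "satisfies (alg_B\<lparr>carrier := D\<rparr>) (fst d, snd d)"
      using Ax(2) d by (auto simp: eq_theory_def)
    ultimately show ?thesis using hyp_alg_satisfies_small[OF E(1,2) _ CD, of "fst d" "snd d"] by simp
  qed
  ultimately have "satisfies ((hyp_alg E)\<lparr>carrier := C\<rparr>) e"
    using entails_any_type[OF _ eq] by blast
  moreover have "cycle_free_upto 2 E"
    using E(2) unfolding cycle_free_upto_def n_def by auto
  ultimately show False
    using hitting_equation_fails[OF E(1) _ k xs(1) l, of C] CD unfolding e_def by auto
qed

section \<open>B as an algebra of growth classes\<close>

text \<open>
  Functions are compared for large arguments only. The classes named in \<open>linear_class\<close> are those of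
  the functions that are eventually \<open>k * x + c\<close>.
\<close>
definition linear_germ :: "nat \<Rightarrow> nat \<Rightarrow> (nat \<Rightarrow> nat) \<Rightarrow> bool" where
  "linear_germ k c f \<longleftrightarrow> (\<forall>\<^sub>F x in sequentially. f x = k * x + c)"

definition superlinear :: "(nat \<Rightarrow> nat) \<Rightarrow> bool" where
  "superlinear f \<longleftrightarrow> (\<forall>k. \<forall>\<^sub>F x in sequentially. k * x < f x)"

definition linear_class :: "nat \<Rightarrow> nat \<Rightarrow> b_elem" where
  "linear_class k c = (if k = 0 then if c = 0 then B0 else if c = 1 then B1 else B2
     else if c = 0 then Ba else Binf)"

definition germ :: "(nat \<Rightarrow> nat) \<Rightarrow> b_elem \<Rightarrow> bool" where
  "germ f b \<longleftrightarrow> (\<exists>k c. linear_germ k c f \<and> b = linear_class k c) \<or> superlinear f \<and> b = Binf"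

definition growing :: "(nat \<Rightarrow> nat) \<Rightarrow> bool" where
  "growing f \<longleftrightarrow> (\<forall>\<^sub>F x in sequentially. x \<le> f x)"

lemma germ_linearI: "linear_germ k c f \<Longrightarrow> b = linear_class k c \<Longrightarrow> germ f b"
  by (auto simp: germ_def)

lemma germ_superlinearI: "superlinear f \<Longrightarrow> germ f Binf"
  by (auto simp: germ_def)

lemma germ_cases:
  assumes "germ f b"
  obtains (const) c where "linear_germ 0 c f" "b = linear_class 0 c"
    | (lin) k c where "linear_germ k c f" "k > 0" "b = linear_class k c"
    | (super) "superlinear f" "b = Binf"
  using assms unfolding germ_def by (metis gr0I)

lemma germ_growing_cases:
  assumes "germ f b"
  obtains (const) c where "linear_germ 0 c f" "b = linear_class 0 c"
    | (grow) "growing f" "b \<in> {Ba, Binf}"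
  using assms
proof (cases rule: germ_cases)
  case (lin k c)
  have "growing f"
    using lin(1) unfolding growing_def linear_germ_def
    by eventually_elim (use lin(2) in \<open>simp add: trans_le_add1\<close>)
  then show ?thesis using lin that(2) by (simp add: linear_class_def)
next
  case super
  then have "\<forall>\<^sub>F x in sequentially. 1 * x < f x" unfolding superlinear_def by blast
  then have "growing f" unfolding growing_def by eventually_elim simp
  then show ?thesis using super that(2) by simp
qed (use that in blast)

lemma superlinear_mono:
  assumes "superlinear f" "\<forall>\<^sub>F x in sequentially. f x \<le> g x"
  shows "superlinear g"
  unfolding superlinear_def
proof
  fix k
  have "\<forall>\<^sub>F x in sequentially. k * x < f x" using assms(1) by (simp add: superlinear_def)
  then show "\<forall>\<^sub>F x in sequentially. k * x < g x" using assms(2) by eventually_elim simp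
qed

text \<open>
  A quadratic lower bound is all that powers, factorials and binomial coefficients of growing
  functions need; the factor \<open>2\<close> is the denominator of a binomial coefficient.
\<close>
lemma superlinear_of_square:
  assumes "\<forall>\<^sub>F x in sequentially. x * x \<le> 2 * f x"
  shows "superlinear f"
  unfolding superlinear_def
proof
  fix k
  have "\<forall>\<^sub>F x in sequentially. 2 * k < x" by (rule eventually_gt_at_top)
  then show "\<forall>\<^sub>F x in sequentially. k * x < f x" using assms
  proof eventually_elim
    case (elim x)
    have "(2 * k) * x < x * x" using elim(1) by (intro mult_strict_right_mono) simp_all
    then have "2 * (k * x) < x * x" by (simp only: mult.assoc)
    then show ?case using elim(2) by linarith
  qed
qed

lemma square_le_two_power: "x * x \<le> 2 * 2 ^ x" for x :: nat
proof (induction x)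
  case (Suc x)
  show ?case
  proof (cases "x \<le> 2")
    case True
    then have "x = 0 \<or> x = 1 \<or> x = 2" by auto
    then show ?thesis by auto
  next
    case False
    then have "3 * x \<le> x * x" by simp
    moreover have "Suc x * Suc x = x * x + 2 * x + 1" by simp
    ultimately have "Suc x * Suc x \<le> 2 * (x * x)" using False by linarith
    also have "\<dots> \<le> 2 * (2 * 2 ^ x)" using Suc by (rule mult_le_mono2)
    finally show ?thesis by simp
  qed
qed simp

lemma square_le_fact: "x * x \<le> 2 * (fact x :: nat)"
proof (induction x)
  case (Suc x)
  show ?case
  proof (cases "x \<le> 1")
    case True
    then have "x = 0 \<or> x = 1" by auto
    then show ?thesis by auto
  next
    case False
    then have "2 * x \<le> x * x" by simp
    then have "Suc x \<le> x * x" using False by linarith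
    then have "Suc x \<le> 2 * fact x" using Suc by (rule order.trans)
    then have "Suc x * Suc x \<le> Suc x * (2 * fact x)" by (rule mult_le_mono2)
    then show ?thesis by (simp add: algebra_simps)
  qed
qed simp

lemma square_le_binomial:
  assumes "x \<le> f" "2 \<le> g"
  shows "x * x \<le> 2 * ((f + g) choose g)"
proof -
  have "(f + 2) choose 2 = (f + 2) choose f" using binomial_symmetric[of 2 "f + 2"] by simp
  also have "\<dots> \<le> (f + g) choose f" using assms(2) by (intro binomial_right_mono) simp
  also have "\<dots> = (f + g) choose g" using binomial_symmetric[of g "f + g"] by simp
  finally have "(f + 2) * (f + 1) div 2 \<le> (f + g) choose g" by (simp add: choose_two)
  moreover have "2 * ((f + 2) * (f + 1) div 2) = (f + 2) * (f + 1)" by simp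
  ultimately have "(f + 2) * (f + 1) \<le> 2 * ((f + g) choose g)" by linarith
  moreover have "x * x \<le> (f + 2) * (f + 1)" using assms(1) by (intro mult_le_mono) simp_all
  ultimately show ?thesis by simp
qed

lemma germ_nonzero:
  assumes "germ f b" "b \<noteq> B0"
  shows "\<forall>\<^sub>F x in sequentially. 1 \<le> f x"
  using assms(1)
proof (cases rule: germ_growing_cases)
  case (const c)
  then have "1 \<le> c" using assms(2) by (auto simp: linear_class_def split: if_splits)
  then show ?thesis using const(1) unfolding linear_germ_def by (auto elim: eventually_mono)
next
  case grow
  have "\<forall>\<^sub>F x in sequentially. (1::nat) \<le> x" by (rule eventually_ge_at_top)
  with grow(1) show ?thesis unfolding growing_def by eventually_elim simp
qed

lemma germ_ge_2:
  assumes "germ f b" "b \<notin> {B0, B1}"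
  shows "\<forall>\<^sub>F x in sequentially. 2 \<le> f x"
  using assms(1)
proof (cases rule: germ_growing_cases)
  case (const c)
  then have "c \<ge> 2" using assms(2) by (auto simp: linear_class_def split: if_splits)
  then show ?thesis using const(1) unfolding linear_germ_def by (auto elim: eventually_mono)
next
  case grow
  have "\<forall>\<^sub>F x in sequentially. (2::nat) \<le> x" by (rule eventually_ge_at_top)
  with grow(1) show ?thesis unfolding growing_def by eventually_elim simp
qed

lemma germ_unique:
  assumes "germ f b" "germ f b'"
  shows "b = b'"
proof -
  have no: False if "superlinear f" "linear_germ k c f" for k c
  proof -
    have "\<forall>\<^sub>F x in sequentially. (k + c) * x < f x" using that(1) by (simp add: superlinear_def)
    moreover have "\<forall>\<^sub>F x in sequentially. (1::nat) \<le> x" by (rule eventually_ge_at_top)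
    ultimately have "\<forall>\<^sub>F x in sequentially. False"
      using that(2) unfolding linear_germ_def
    proof eventually_elim
      case (elim x)
      have "c * 1 \<le> c * x" using elim(2) by (rule mult_le_mono2)
      then show False using elim by (simp add: algebra_simps)
    qed
    then show False by simp
  qed
  have eq: "k = k' \<and> c = c'" if kc: "linear_germ k c f" "linear_germ k' c' f" for k c k' c'
  proof -
    have "\<forall>\<^sub>F x in sequentially. k * x + c = k' * x + c'"
      using kc unfolding linear_germ_def by eventually_elim simp
    then obtain n where n: "\<And>x. x \<ge> n \<Longrightarrow> k * x + c = k' * x + c'"
      unfolding eventually_sequentially by blast
    have "k * n + c = k' * n + c'" "k * Suc n + c = k' * Suc n + c'" using n[of n] n[of "Suc n"] by simp_all
    then have "k = k'" by simp
    then show ?thesis using \<open>k * n + c = _\<close> by simp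
  qed
  show ?thesis using assms no eq unfolding germ_def by blast
qed

lemma germ_cong:
  assumes "\<forall>\<^sub>F x in sequentially. f x = g x" "germ f b"
  shows "germ g b"
proof -
  have "linear_germ k c g" if "linear_germ k c f" for k c
    using assms(1) that unfolding linear_germ_def by eventually_elim simp
  moreover have "superlinear g" if "superlinear f"
    using that by (rule superlinear_mono) (use assms(1) in \<open>auto elim: eventually_mono\<close>)
  ultimately show ?thesis using assms(2) unfolding germ_def by blast
qed

lemma germ_const: "germ (\<lambda>x. c) (linear_class 0 c)"
  by (rule germ_linearI[of 0 c]) (simp_all add: linear_germ_def)

lemma germ_eventually_const:
  assumes "\<forall>\<^sub>F x in sequentially. f x = c" "b = linear_class 0 c"
  shows "germ f b"
  using assms by (intro germ_linearI[of 0 c]) (simp_all add: linear_germ_def)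

lemma germ_Fact:
  assumes "germ f b"
  shows "germ (\<lambda>x. fact (f x)) (b_op1 Fact b)"
  using assms
proof (cases rule: germ_growing_cases)
  case (const c)
  have "2 \<le> (fact c :: nat)" if "2 \<le> c" using that fact_ge_self[of c] by simp
  then have "b_op1 Fact b = linear_class 0 (fact c)"
    unfolding const(2) by (auto simp: linear_class_def le_Suc_eq numeral_2_eq_2 not_less_eq_eq)
  moreover have "\<forall>\<^sub>F x in sequentially. fact (f x) = (fact c :: nat)"
    using const(1) unfolding linear_germ_def by eventually_elim simp
  ultimately show ?thesis by (intro germ_eventually_const[of _ "fact c"])
next
  case grow
  have "superlinear (\<lambda>x. fact (f x))"
  proof (rule superlinear_of_square)
    show "\<forall>\<^sub>F x in sequentially. x * x \<le> 2 * (fact (f x) :: nat)"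
      using grow(1) unfolding growing_def
    proof eventually_elim
      case (elim x)
      show ?case using square_le_fact[of x] fact_mono[OF elim, where 'a = nat] by linarith
    qed
  qed
  moreover have "b_op1 Fact b = Binf" using grow(2) by auto
  ultimately show ?thesis using germ_superlinearI by simp
qed

lemma superlinear_two_power:
  assumes "growing f"
  shows "superlinear (\<lambda>x. 2 ^ f x)"
proof (rule superlinear_of_square)
  show "\<forall>\<^sub>F x in sequentially. x * x \<le> 2 * 2 ^ f x"
    using assms unfolding growing_def
  proof eventually_elim
    case (elim x)
    then have "(2::nat) ^ x \<le> 2 ^ f x" by (intro power_increasing) simp_all
    then show ?case using square_le_two_power[of x] by linarith
  qed
qed

lemma germ_Exp2:
  assumes "germ f b"
  shows "germ (\<lambda>x. 2 ^ f x) (b_op1 Exp2 b)"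
  using assms
proof (cases rule: germ_growing_cases)
  case (const c)
  have "2 ^ c \<noteq> Suc 0" "(2::nat) ^ c \<noteq> 0" if "c \<noteq> 0" using that by auto
  then have "b_op1 Exp2 b = linear_class 0 (2 ^ c)"
    unfolding const(2) by (simp add: linear_class_def)
  moreover have "\<forall>\<^sub>F x in sequentially. 2 ^ f x = (2 ^ c :: nat)"
    using const(1) unfolding linear_germ_def by eventually_elim simp
  ultimately show ?thesis by (intro germ_eventually_const[of _ "2 ^ c"])
next
  case grow
  then have "b_op1 Exp2 b = Binf" by auto
  then show ?thesis using germ_superlinearI superlinear_two_power[OF grow(1)] by simp
qed

lemma germ_Add:
  assumes f: "germ f b" and g: "germ g d"
  shows "germ (\<lambda>x. f x + g x) (b_op2 Add b d)"
proof -
  have "germ (\<lambda>x. f x + g x) Binf" if "superlinear f \<or> superlinear g"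
    using that superlinear_mono[of f "\<lambda>x. f x + g x"] superlinear_mono[of g "\<lambda>x. f x + g x"]
    by (auto intro: germ_superlinearI)
  moreover have "b_op2 Add b Binf = Binf" "b_op2 Add Binf b = Binf" for b by (cases b; simp)+
  moreover have "germ (\<lambda>x. f x + g x) (b_op2 Add b d)"
    if "linear_germ k c f" "linear_germ k' c' g" "b = linear_class k c" "d = linear_class k' c'" for k c k' c'
  proof (rule germ_linearI[of "k + k'" "c + c'"])
    show "linear_germ (k + k') (c + c') (\<lambda>x. f x + g x)"
      using that(1,2) unfolding linear_germ_def by eventually_elim (simp add: algebra_simps)
    show "b_op2 Add b d = linear_class (k + k') (c + c')"
      unfolding that(3,4) by (simp add: linear_class_def)
  qed
  ultimately show ?thesis using f g unfolding germ_def by metis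
qed

lemma germ_const_Mul:
  assumes g: "germ g d"
  shows "germ (\<lambda>x. c * g x) (b_op2 Mul (linear_class 0 c) d)"
  using g
proof (cases "c = 0")
  case True
  then show ?thesis
    using germ_const[of 0] by (cases d) (simp_all add: linear_class_def)
next
  case False
  show ?thesis
    using g unfolding germ_def[of g d]
  proof (elim disjE exE conjE)
    fix k c' assume g: "linear_germ k c' g" and d: "d = linear_class k c'"
    have "linear_germ (c * k) (c * c') (\<lambda>x. c * g x)"
      using g unfolding linear_germ_def by eventually_elim (simp add: algebra_simps)
    moreover have "b_op2 Mul (linear_class 0 c) d = linear_class (c * k) (c * c')"
      using False unfolding d by (auto simp: linear_class_def)
    ultimately show ?thesis by (rule germ_linearI)
  next
    assume g: "superlinear g" and d: "d = Binf"
    have "superlinear (\<lambda>x. c * g x)"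
      using g by (rule superlinear_mono) (use False in simp)
    moreover have "b_op2 Mul (linear_class 0 c) d = Binf" using False d by (simp add: linear_class_def)
    ultimately show ?thesis using germ_superlinearI by simp
  qed
qed

lemma germ_Mul:
  assumes f: "germ f b" and g: "germ g d"
  shows "germ (\<lambda>x. f x * g x) (b_op2 Mul b d)"
  using f
proof (cases rule: germ_growing_cases)
  case (const c)
  have "germ (\<lambda>x. c * g x) (b_op2 Mul b d)" using germ_const_Mul[OF g] const(2) by simp
  moreover have "\<forall>\<^sub>F x in sequentially. c * g x = f x * g x"
    using const(1) unfolding linear_germ_def by eventually_elim simp
  ultimately show ?thesis by (rule germ_cong[rotated])
next
  case fg: grow
  show ?thesis using g
  proof (cases rule: germ_growing_cases)
    case (const c)
    have "b_op2 Mul b d = b_op2 Mul d b" for b d by (cases b; cases d; simp)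
    then have "germ (\<lambda>x. c * f x) (b_op2 Mul b d)" using germ_const_Mul[OF f] const(2) by simp
    moreover have "\<forall>\<^sub>F x in sequentially. c * f x = f x * g x"
      using const(1) unfolding linear_germ_def by eventually_elim simp
    ultimately show ?thesis by (rule germ_cong[rotated])
  next
    case grow
    have "superlinear (\<lambda>x. f x * g x)"
    proof (rule superlinear_of_square)
      show "\<forall>\<^sub>F x in sequentially. x * x \<le> 2 * (f x * g x)"
        using fg(1) grow(1) unfolding growing_def
        by eventually_elim (simp add: mult_le_mono trans_le_add1 mult_2)
    qed
    moreover have "b_op2 Mul b d = Binf" using fg(2) grow(2) by auto
    ultimately show ?thesis using germ_superlinearI by simp
  qed
qed

text \<open>
  Apart from the entries in which the table ignores one argument or both functions are constant,
  either the exponent grows over a base of at least \<open>2\<close>, or the base grows under an exponent of at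
  least \<open>2\<close>; both powers are superlinear.
\<close>
lemma germ_Exp:
  assumes f: "germ f b" and g: "germ g d"
  shows "germ (\<lambda>x. f x ^ g x) (b_op2 Exp b d)"
proof -
  have const: "\<exists>c. (\<forall>\<^sub>F x in sequentially. f x = c) \<and> b = linear_class 0 c" if "germ f b" "b \<in> {B0, B1, B2}" for f b
    using that(1) by (cases rule: germ_growing_cases) (use that(2) in \<open>auto simp: linear_germ_def\<close>)
  consider "d = B0" | "d \<noteq> B0" "b = B0" | "b = B1" | "d = B1" | "b = B2" "d = B2"
    | "b = B2" "d \<in> {Ba, Binf}" | "b \<in> {Ba, Binf}" "d \<notin> {B0, B1}"
    by (cases b; cases d; simp)
  then show ?thesis
  proof cases
    case 1
    then obtain c where "\<forall>\<^sub>F x in sequentially. g x = c" "B0 = linear_class 0 c" using const[OF g] by auto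
    then have "\<forall>\<^sub>F x in sequentially. g x = 0" by (auto simp: linear_class_def split: if_splits)
    then have "\<forall>\<^sub>F x in sequentially. f x ^ g x = 1" by eventually_elim simp
    then show ?thesis
      by (rule germ_eventually_const) (use 1 in \<open>cases b; simp add: linear_class_def\<close>)
  next
    case 2
    then obtain c where "\<forall>\<^sub>F x in sequentially. f x = c" "B0 = linear_class 0 c" using const[OF f] by auto
    then have "\<forall>\<^sub>F x in sequentially. f x = 0" by (auto simp: linear_class_def split: if_splits)
    with germ_nonzero[OF g 2(1)] have "\<forall>\<^sub>F x in sequentially. f x ^ g x = 0" by eventually_elim simp
    then show ?thesis
      by (rule germ_eventually_const) (use 2 in \<open>cases d; simp add: linear_class_def\<close>)
  next
    case 3
    then obtain c where "\<forall>\<^sub>F x in sequentially. f x = c" "B1 = linear_class 0 c" using const[OF f] by auto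
    then have "\<forall>\<^sub>F x in sequentially. f x = 1" by (auto simp: linear_class_def split: if_splits)
    then have "\<forall>\<^sub>F x in sequentially. f x ^ g x = 1" by eventually_elim simp
    then show ?thesis
      by (rule germ_eventually_const) (use 3 in \<open>cases d; simp add: linear_class_def\<close>)
  next
    case 4
    then obtain c where "\<forall>\<^sub>F x in sequentially. g x = c" "B1 = linear_class 0 c" using const[OF g] by auto
    then have "\<forall>\<^sub>F x in sequentially. g x = 1" by (auto simp: linear_class_def split: if_splits)
    then have "\<forall>\<^sub>F x in sequentially. f x = f x ^ g x" by eventually_elim simp
    moreover have "b_op2 Exp b d = b" using 4 by (cases b) simp_all
    ultimately show ?thesis using germ_cong f by metis
  next
    case 5
    then obtain c where c: "\<forall>\<^sub>F x in sequentially. f x = c" "B2 = linear_class 0 c" using const[OF f] by auto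
    obtain c' where c': "\<forall>\<^sub>F x in sequentially. g x = c'" "B2 = linear_class 0 c'" using const[OF g] 5 by auto
    have "2 \<le> c" "2 \<le> c'" using c(2) c'(2) by (auto simp: linear_class_def split: if_splits)
    then have "c ^ c' \<noteq> 0" "c ^ c' \<noteq> Suc 0" by auto
    then have "B2 = linear_class 0 (c ^ c')" by (simp add: linear_class_def)
    moreover have "\<forall>\<^sub>F x in sequentially. f x ^ g x = c ^ c'" using c(1) c'(1) by eventually_elim simp
    ultimately show ?thesis using 5 by (intro germ_eventually_const) auto
  next
    case 6
    have "growing g" using g by (cases rule: germ_growing_cases) (use 6 in \<open>auto simp: linear_class_def split: if_splits\<close>)
    moreover have "\<forall>\<^sub>F x in sequentially. 2 ^ g x \<le> f x ^ g x"
    proof -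
      have "\<forall>\<^sub>F x in sequentially. 2 \<le> f x" using 6 by (intro germ_ge_2[OF f]) simp
      then show ?thesis by eventually_elim (rule power_mono, simp_all)
    qed
    ultimately have "superlinear (\<lambda>x. f x ^ g x)" by (rule superlinear_mono[OF superlinear_two_power])
    moreover have "b_op2 Exp b d = Binf" using 6 by auto
    ultimately show ?thesis using germ_superlinearI by simp
  next
    case 7
    have "growing f" using f by (cases rule: germ_growing_cases) (use 7 in \<open>auto simp: linear_class_def split: if_splits\<close>)
    have "superlinear (\<lambda>x. f x ^ g x)"
    proof (rule superlinear_of_square)
      show "\<forall>\<^sub>F x in sequentially. x * x \<le> 2 * f x ^ g x"
        using \<open>growing f\<close> germ_ge_2[OF g 7(2)] unfolding growing_def
      proof eventually_elim
        case (elim x)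
        have "x * x \<le> f x ^ 2" using elim(1) by (simp add: power2_eq_square mult_le_mono)
        also have "\<dots> \<le> f x ^ g x"
          using elim(2) by (cases "f x = 0") (simp_all add: power_increasing)
        finally show ?case by simp
      qed
    qed
    moreover have "b_op2 Exp b d = Binf" using 7 by (cases d) auto
    ultimately show ?thesis using germ_superlinearI by simp
  qed
qed

lemma germ_Suc:
  assumes "germ f b" "b \<in> {Ba, Binf}"
  shows "germ (\<lambda>x. Suc (f x)) Binf"
proof -
  have "germ (\<lambda>x. f x + 1) (b_op2 Add b B1)"
    using germ_Add[OF assms(1) germ_const[of 1]] by (simp add: linear_class_def)
  then show ?thesis using assms(2) by auto
qed

text \<open>
  If one argument is eventually \<open>1\<close>, the binomial coefficient is the successor of the other. If
  both are at least \<open>2\<close> and one grows, it is at least quadratic.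
\<close>
lemma germ_Binom:
  assumes f: "germ f b" and g: "germ g d"
  shows "germ (\<lambda>x. (f x + g x) choose g x) (b_op2 Binom b d)"
proof -
  have const: "\<exists>c. (\<forall>\<^sub>F x in sequentially. f x = c) \<and> b = linear_class 0 c" if "germ f b" "b \<in> {B0, B1, B2}" for f b
    using that(1) by (cases rule: germ_growing_cases) (use that(2) in \<open>auto simp: linear_germ_def\<close>)
  have sym: "(m + n) choose n = (m + n) choose m" for m n :: nat
    using binomial_symmetric[of n "m + n"] by simp
  have zero: "\<forall>\<^sub>F x in sequentially. f x = 0" if fb: "germ f B0" for f
  proof -
    obtain c where c: "\<forall>\<^sub>F x in sequentially. f x = c" "B0 = linear_class 0 c" using const[OF fb] by auto
    then have "c = 0" by (simp add: linear_class_def split: if_splits)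
    then show ?thesis using c(1) by simp
  qed
  have one: "\<forall>\<^sub>F x in sequentially. f x = 1" if fb: "germ f B1" for f
  proof -
    obtain c where c: "\<forall>\<^sub>F x in sequentially. f x = c" "B1 = linear_class 0 c" using const[OF fb] by auto
    then have "c = 1" by (simp add: linear_class_def split: if_splits)
    then show ?thesis using c(1) by simp
  qed
  have grow: "growing f" if "germ f b" "b \<in> {Ba, Binf}" for f b
    using that(1) by (cases rule: germ_growing_cases) (use that(2) in \<open>auto simp: linear_class_def split: if_splits\<close>)
  consider "d = B0" | "b = B0" | "b \<in> {B1, B2}" "d \<in> {B1, B2}"
    | "b = B1" "d \<in> {Ba, Binf}" | "d = B1" "b \<in> {Ba, Binf}"
    | "b \<in> {Ba, Binf}" "d \<notin> {B0, B1}" | "b \<notin> {B0, B1}" "d \<in> {Ba, Binf}"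
    by (cases b; cases d; simp)
  then show ?thesis
  proof cases
    case 1
    then have "\<forall>\<^sub>F x in sequentially. (f x + g x) choose g x = 1"
      using zero[of g] g by (auto elim: eventually_mono)
    then show ?thesis
      by (rule germ_eventually_const) (use 1 in \<open>cases b; simp add: linear_class_def\<close>)
  next
    case 2
    then have "\<forall>\<^sub>F x in sequentially. (f x + g x) choose g x = 1"
      using zero[of f] f by (auto elim: eventually_mono)
    then show ?thesis
      by (rule germ_eventually_const) (use 2 in \<open>cases d; simp add: linear_class_def\<close>)
  next
    case 3
    then obtain c where c: "\<forall>\<^sub>F x in sequentially. f x = c" "b = linear_class 0 c" using const[OF f] by auto
    obtain c' where c': "\<forall>\<^sub>F x in sequentially. g x = c'" "d = linear_class 0 c'" using const[OF g] 3 by auto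
    have "1 \<le> c" "1 \<le> c'" using c(2) c'(2) 3 by (auto simp: linear_class_def split: if_splits)
    then obtain m n where mn: "c = Suc m" "c' = Suc n" by (metis Suc_le_D One_nat_def)
    have "0 < (m + Suc n) choose n" "0 < (m + Suc n) choose Suc n" by (simp_all add: zero_less_binomial)
    moreover have "(Suc m + Suc n) choose Suc n = ((m + Suc n) choose n) + ((m + Suc n) choose Suc n)" by simp
    ultimately have "(c + c') choose c' \<noteq> 0" "(c + c') choose c' \<noteq> Suc 0" unfolding mn by linarith+
    then have "B2 = linear_class 0 ((c + c') choose c')" by (simp add: linear_class_def)
    moreover have "\<forall>\<^sub>F x in sequentially. (f x + g x) choose g x = (c + c') choose c'"
      using c(1) c'(1) by eventually_elim simp
    ultimately show ?thesis using 3 by (intro germ_eventually_const) auto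
  next
    case 4
    have "\<forall>\<^sub>F x in sequentially. Suc (g x) = (f x + g x) choose g x"
      using one[of f] f 4 by (auto elim!: eventually_mono simp: binomial_Suc_n)
    from germ_cong[OF this germ_Suc[OF g 4(2)]] show ?thesis using 4 by auto
  next
    case 5
    have "\<forall>\<^sub>F x in sequentially. Suc (f x) = (f x + g x) choose g x"
      using one[of g] g 5 by (auto elim!: eventually_mono)
    from germ_cong[OF this germ_Suc[OF f 5(2)]] show ?thesis using 5 by auto
  next
    case 6
    have "superlinear (\<lambda>x. (f x + g x) choose g x)"
    proof (rule superlinear_of_square)
      show "\<forall>\<^sub>F x in sequentially. x * x \<le> 2 * ((f x + g x) choose g x)"
        using grow[OF f 6(1)] germ_ge_2[OF g 6(2)] unfolding growing_def
        by eventually_elim (rule square_le_binomial)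
    qed
    moreover have "b_op2 Binom b d = Binf" using 6 by (cases d) auto
    ultimately show ?thesis using germ_superlinearI by simp
  next
    case 7
    have "superlinear (\<lambda>x. (f x + g x) choose g x)"
    proof (rule superlinear_of_square)
      show "\<forall>\<^sub>F x in sequentially. x * x \<le> 2 * ((f x + g x) choose g x)"
        using grow[OF g 7(2)] germ_ge_2[OF f 7(1)] unfolding growing_def
      proof eventually_elim
        case (elim x)
        show ?case using square_le_binomial[OF elim(1,2)] sym[of "f x" "g x"] by (simp add: add.commute)
      qed
    qed
    moreover have "b_op2 Binom b d = Binf" using 7 by (cases b) auto
    ultimately show ?thesis using germ_superlinearI by simp
  qed
qed

primrec germ_rep :: "b_elem \<Rightarrow> nat \<Rightarrow> nat" where
  "germ_rep B0 x = 0"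
| "germ_rep B1 x = 1"
| "germ_rep B2 x = 2"
| "germ_rep Ba x = x"
| "germ_rep Binf x = Suc x"

lemma germ_germ_rep: "germ (germ_rep b) b"
proof -
  have "linear_germ 0 0 (germ_rep B0)" "linear_germ 0 1 (germ_rep B1)" "linear_germ 0 2 (germ_rep B2)"
    "linear_germ 1 0 (germ_rep Ba)" "linear_germ 1 1 (germ_rep Binf)"
    by (simp_all add: linear_germ_def)
  then show ?thesis
    by (cases b) (auto intro!: germ_linearI simp: linear_class_def)
qed

lemma germ_eval:
  "germ (\<lambda>x. eval alg_N0 (\<lambda>n. germ_rep (v n) x) t) (eval alg_B v t)"
proof (induction t)
  case (Var n)
  show ?case using germ_germ_rep[of "v n"] by simp
next
  case (App0 f)
  show ?case using germ_const[of 0] germ_const[of 1]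
    by (cases f) (simp_all add: alg_N0_def alg_B_def linear_class_def)
next
  case (App1 f s)
  then show ?case
    using germ_Fact[OF App1] germ_Exp2[OF App1]
    by (cases f) (simp_all add: alg_N0_def alg_B_def)
next
  case (App2 f s t)
  then show ?case
    using germ_Add[OF App2] germ_Mul[OF App2] germ_Exp[OF App2] germ_Binom[OF App2]
    by (cases f) (simp_all add: alg_N0_def alg_B_def)
qed

text \<open>
  For positive arguments the representatives of the nonzero classes are positive, so an equation is
  needed only for positive numbers when \<open>B0\<close> is excluded.
\<close>
lemma satisfies_transfer:
  assumes CD: "(C, D) \<in> {(UNIV, UNIV), ({1..}, - {B0})}"
    and sat: "satisfies (alg_N0\<lparr>carrier := C\<rparr>) (s, t)"
  shows "satisfies (alg_B\<lparr>carrier := D\<rparr>) (s, t)"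
  unfolding satisfies_def
proof (intro allI impI)
  fix v :: "nat \<Rightarrow> b_elem"
  assume v: "range v \<subseteq> carrier (alg_B\<lparr>carrier := D\<rparr>)"
  have pos: "1 \<le> germ_rep b x" if "1 \<le> x" "b \<noteq> B0" for b and x :: nat using that by (cases b) simp_all
  have "\<forall>\<^sub>F x in sequentially. (1::nat) \<le> x" by (rule eventually_ge_at_top)
  then have "\<forall>\<^sub>F x in sequentially.
    eval alg_N0 (\<lambda>n. germ_rep (v n) x) s = eval alg_N0 (\<lambda>n. germ_rep (v n) x) t"
  proof eventually_elim
    case (elim x)
    have "germ_rep (v n) x \<in> C" for n
    proof (cases "C = UNIV")
      case False
      then have CD': "C = {1..}" "D = - {B0}" using CD by auto
      have "v n \<in> D" using range_subsetD[OF v, of n] by simp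
      then have "v n \<noteq> B0" using CD'(2) by simp
      then show ?thesis using pos[OF elim] CD'(1) by simp
    qed simp
    then have "range (\<lambda>n. germ_rep (v n) x) \<subseteq> C" by blast
    then show ?case using sat by (simp add: satisfies_def)
  qed
  from germ_unique[OF germ_cong[OF this germ_eval] germ_eval]
  show "eval (alg_B\<lparr>carrier := D\<rparr>) v (fst (s, t)) = eval (alg_B\<lparr>carrier := D\<rparr>) v (snd (s, t))"
    by simp
qed

section \<open>The variety and the missing finite basis\<close>

theorem theorem3p2:
  shows
    "(\<forall>\<tau>. {Binary Add, Binary Mul, Nullary Zero, Nullary One} \<subseteq> \<tau> \<and>
          \<tau> \<subseteq> {Binary Add, Binary Mul, Binary Exp, Binary Binom, Unary Fact, Unary Exp2,
                Nullary Zero, Nullary One} \<longrightarrow>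
          in_variety_generated_by \<tau> alg_B alg_N0 \<and> \<not> finitely_axiomatisable \<tau> alg_B)
     \<and>
     (\<forall>\<tau>. {Binary Add, Binary Mul, Nullary One} \<subseteq> \<tau> \<and>
          \<tau> \<subseteq> {Binary Add, Binary Mul, Binary Exp, Binary Binom, Unary Fact, Unary Exp2,
                Nullary One} \<longrightarrow>
          in_variety_generated_by \<tau> alg_B_minus alg_N \<and> \<not> finitely_axiomatisable \<tau> alg_B_minus)"
proof (intro conjI allI impI)
  have B: "alg_B = alg_B\<lparr>carrier := UNIV\<rparr>" and N0: "alg_N0 = alg_N0\<lparr>carrier := UNIV\<rparr>"
    by (simp_all add: alg_B_def alg_N0_def)
  have B_minus: "alg_B_minus = alg_B\<lparr>carrier := - {B0}\<rparr>"
  proof -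
    have "{B1, B2, Ba, Binf} = - {B0}" using b_elem.exhaust by blast
    then show ?thesis by (simp add: alg_B_minus_def)
  qed
  {
    fix \<tau> :: "opsym set"
    assume \<tau>: "{Binary Add, Binary Mul, Nullary Zero, Nullary One} \<subseteq> \<tau> \<and>
      \<tau> \<subseteq> {Binary Add, Binary Mul, Binary Exp, Binary Binom, Unary Fact, Unary Exp2,
        Nullary Zero, Nullary One}"
    have "satisfies alg_B e" if "e \<in> eq_theory \<tau> alg_N0" for e
      using satisfies_transfer[of UNIV UNIV "fst e" "snd e"] that B N0 by (simp add: eq_theory_def)
    then show "in_variety_generated_by \<tau> alg_B alg_N0"
      by (simp add: in_variety_generated_by_def is_algebra_def)
    show "\<not> finitely_axiomatisable \<tau> alg_B"
      using no_finite_axiomatisation[of \<tau> UNIV UNIV] \<tau> B by simp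
  }
  {
    fix \<tau> :: "opsym set"
    assume \<tau>: "{Binary Add, Binary Mul, Nullary One} \<subseteq> \<tau> \<and>
      \<tau> \<subseteq> {Binary Add, Binary Mul, Binary Exp, Binary Binom, Unary Fact, Unary Exp2, Nullary One}"
    have zero: "Nullary Zero \<notin> \<tau>" using \<tau> by blast
    have "b_op0 f \<noteq> B0" if "Nullary f \<in> \<tau>" for f using that zero by (cases f) auto
    moreover have "b_op1 f x \<noteq> B0" for f x by (cases f; cases x) simp_all
    moreover have "b_op2 f x y \<noteq> B0" if "x \<noteq> B0" "y \<noteq> B0" for f x y
      using that by (cases f; cases x; cases y) simp_all
    ultimately have "is_algebra \<tau> alg_B_minus"
      unfolding B_minus by (auto simp: is_algebra_def alg_B_def)
    moreover have "satisfies alg_B_minus e" if "e \<in> eq_theory \<tau> alg_N" for e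
      using satisfies_transfer[of "{1..}" "- {B0}" "fst e" "snd e"] that
      by (simp add: eq_theory_def B_minus alg_N_def)
    ultimately show "in_variety_generated_by \<tau> alg_B_minus alg_N"
      by (simp add: in_variety_generated_by_def)
    show "\<not> finitely_axiomatisable \<tau> alg_B_minus"
      using no_finite_axiomatisation[of \<tau> "- {N0}" "- {B0}"] \<tau> zero B_minus by simp
  }
qed

end
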